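(* There is an algorithm, whose inputs are a finite set $E\subset\mathbb{R}^d$ with $\#(E)=N$ and a 1-field $\mathcal{P}_E=\{P_x\in\mathcal{P}:x\in E\}$, that computes $\mathcal{L}(\mathcal{P}_E)$ exactly. It requires $O(dN^2)$ work and $O(dN)$ storage.
   Context: $|\cdot|$ is the Euclidean norm. For $g:\mathbb{R}^d\to\mathbb{R}^n$, $\mathrm{Lip}(g)=\sup_{x\neq y}\frac{|g(x)-g(y)|}{|x-y|}$. $C^{1,1}(\mathbb{R}^d)$ is the set of differentiable functions $g:\mathbb{R}^d\to\mathbb{R}$ with $\mathrm{Lip}(\nabla g)<\infty$. $\mathcal{P}$ is the set of first order polynomials (affine functions) $\mathbb{R}^d\to\mathbb{R}$. For $F\in C^{1,1}(\mathbb{R}^d)$, the first order jet of $F$ at $x$ is $J_xF\in\mathcal{P}$, $J_xF(z)=F(x)+\nabla F(x)\cdot(z-x)$. A (Whitney) 1-field on a finite set $E\subset\mathbb{R}^d$ is a family $\mathcal{P}_E=\{P_x\in\mathcal{P}:x\in E\}$ indexed by $E$. Define $$\mathcal{L}(\mathcal{P}_E)=\inf\{\mathrm{Lip}(\nabla F): F\in C^{1,1}(\mathbb{R}^d)\text{ and }J_xF=P_x\ \forall x\in E\}.$$ Inputting $\mathcal{P}_E$ means inputting $P_x(x)\in\mathbb{R}$ and $\nabla P_x\in\mathbb{R}^d$ for each $x\in E$. Model of computation: an idealized computer with standard von Neumann architecture, able to work with exact real numbers (roundoff, overflow and underflow errors are ignored). An exact real number can be stored at each memory address. It takes one machine operation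 to add, subtract, multiply, or divide two real numbers $x$ and $y$, or to compare them (decide whether $x<y$, $x>y$ or $x=y$). The work of an algorithm is the number of machine operations needed to carry it out, and its storage is the number of random access memory addresses required.
   Formalization: The machine may also extract a square root in one operation: with only +, -, *, / and comparison the claim fails (d=1, E={0,1}, values 0, gradients 1 and 0 give 1+√2). Also d≥1 is assumed, and the work and storage bounds are stated for N≥1. *)

theory Defs
  imports "Jordan_Normal_Form.Matrix" "HOL-Library.Extended_Real"
begin

section \<open>Functions of class \<open>C\<^sup>1\<^sup>,\<^sup>1\<close> and 1-fields\<close>

text \<open>
  One program has to serve all dimensions, so \<open>d\<close> is a number and not a type: \<open>\<real>\<^sup>d\<close> is
  \<^term>\<open>carrier_vec d :: real vec set\<close>. Functions on \<open>\<real>\<^sup>d\<close> are total functions on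
  \<^typ>\<open>real vec\<close> whose values outside \<^term>\<open>carrier_vec d\<close> are irrelevant.
\<close>

definition vnorm :: "real vec \<Rightarrow> real" where
  "vnorm v = sqrt (v \<bullet> v)"

definition Lip :: "nat \<Rightarrow> (real vec \<Rightarrow> real vec) \<Rightarrow> ereal" where
  "Lip d g = (SUP (x, y) \<in> {(x, y). x \<in> carrier_vec d \<and> y \<in> carrier_vec d \<and> x \<noteq> y}.
     ereal (vnorm (g x - g y) / vnorm (x - y)))"

definition has_gradient :: "nat \<Rightarrow> (real vec \<Rightarrow> real) \<Rightarrow> real vec \<Rightarrow> real vec \<Rightarrow> bool" where
  "has_gradient d F g x \<longleftrightarrow> g \<in> carrier_vec d \<and>
     (\<forall>e>0. \<exists>\<delta>>0. \<forall>y\<in>carrier_vec d. vnorm (y - x) < \<delta> \<longrightarrow>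
        \<bar>F y - F x - g \<bullet> (y - x)\<bar> \<le> e * vnorm (y - x))"

definition gradient :: "nat \<Rightarrow> (real vec \<Rightarrow> real) \<Rightarrow> real vec \<Rightarrow> real vec" where
  "gradient d F x = (THE g. has_gradient d F g x)"

definition C11 :: "nat \<Rightarrow> (real vec \<Rightarrow> real) set" where
  "C11 d = {F. (\<forall>x\<in>carrier_vec d. \<exists>g. has_gradient d F g x) \<and> Lip d (gradient d F) < \<infinity>}"

definition affine_fun :: "nat \<Rightarrow> (real vec \<Rightarrow> real) \<Rightarrow> bool" where
  "affine_fun d p \<longleftrightarrow> (\<exists>c. \<exists>a\<in>carrier_vec d. \<forall>z\<in>carrier_vec d. p z = c + a \<bullet> z)"

definition jet :: "nat \<Rightarrow> (real vec \<Rightarrow> real) \<Rightarrow> real vec \<Rightarrow> real vec \<Rightarrow> real" where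
  "jet d F x z = F x + gradient d F x \<bullet> (z - x)"

definition one_field :: "nat \<Rightarrow> real vec set \<Rightarrow> (real vec \<Rightarrow> real vec \<Rightarrow> real) \<Rightarrow> bool" where
  "one_field d E P \<longleftrightarrow> (\<forall>x\<in>E. affine_fun d (P x))"

definition minimal_Lip :: "nat \<Rightarrow> real vec set \<Rightarrow> (real vec \<Rightarrow> real vec \<Rightarrow> real) \<Rightarrow> ereal" where
  "minimal_Lip d E P =
     (INF F \<in> {F \<in> C11 d. \<forall>x\<in>E. \<forall>z\<in>carrier_vec d. jet d F x z = P x z}. Lip d (gradient d F))"

section \<open>Real random access machines\<close>

text \<open>
  Every memory cell holds one real number. Integer literals are the only constants a program can
  mention, so no information can be hidden in its code. Every executed instruction, including data
  transfers and branches, counts as one unit of work. The square root is a primitive because the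
  number to be computed is in general irrational for rational data, hence not obtainable from the
  data and integers by field operations and comparisons.
\<close>

datatype arith = Add | Sub | Mul | Div

datatype instr =
    Const nat int                \<comment> \<open>\<open>m[a] := c\<close>\<close>
  | Arith arith nat nat nat      \<comment> \<open>\<open>m[a] := m[b] op m[c]\<close>\<close>
  | Sqrt nat nat                 \<comment> \<open>\<open>m[a] := sqrt m[b]\<close>\<close>
  | Fetch nat nat                \<comment> \<open>\<open>m[a] := m[m[b]]\<close>\<close>
  | Store nat nat                \<comment> \<open>\<open>m[m[a]] := m[b]\<close>\<close>
  | Branch nat nat nat nat nat   \<comment> \<open>go to \<open>l1\<close>, \<open>l2\<close>, \<open>l3\<close> as \<open>m[a] <\<close>, \<open>=\<close>, \<open>> m[b]\<close>\<close>

type_synonym memory = "nat \<Rightarrow> real"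
type_synonym config = "nat \<times> memory"

fun arith_op :: "arith \<Rightarrow> real \<Rightarrow> real \<Rightarrow> real option" where
  "arith_op Add x y = Some (x + y)"
| "arith_op Sub x y = Some (x - y)"
| "arith_op Mul x y = Some (x * y)"
| "arith_op Div x y = (if y = 0 then None else Some (x / y))"

definition address :: "real \<Rightarrow> nat option" where
  "address r = (if r \<in> \<nat> then Some (nat \<lfloor>r\<rfloor>) else None)"

text \<open>The result \<^term>\<open>None\<close> means that the machine is stuck: division by zero, root of a negative
  number, or use of a cell content that is not a natural number as an address.\<close>

fun exec :: "instr \<Rightarrow> config \<Rightarrow> config option" where
  "exec (Const a c) (pc, m) = Some (pc + 1, m(a := of_int c))"
| "exec (Arith f a b c) (pc, m) = map_option (\<lambda>r. (pc + 1, m(a := r))) (arith_op f (m b) (m c))"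
| "exec (Sqrt a b) (pc, m) = (if m b < 0 then None else Some (pc + 1, m(a := sqrt (m b))))"
| "exec (Fetch a b) (pc, m) = map_option (\<lambda>i. (pc + 1, m(a := m i))) (address (m b))"
| "exec (Store a b) (pc, m) = map_option (\<lambda>i. (pc + 1, m(i := m b))) (address (m a))"
| "exec (Branch a b l1 l2 l3) (pc, m) =
     Some (if m a < m b then l1 else if m a = m b then l2 else l3, m)"

fun accessed :: "instr \<Rightarrow> memory \<Rightarrow> nat set" where
  "accessed (Const a c) m = {a}"
| "accessed (Arith f a b c) m = {a, b, c}"
| "accessed (Sqrt a b) m = {a, b}"
| "accessed (Fetch a b) m = {a, b} \<union> set_option (address (m b))"
| "accessed (Store a b) m = {a, b} \<union> set_option (address (m a))"
| "accessed (Branch a b l1 l2 l3) m = {a, b}"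

text \<open>\<open>run prog s t A s'\<close>: from \<open>s\<close> the machine reaches \<open>s'\<close> in exactly \<open>t\<close> steps, and \<open>A\<close> is the
  set of addresses read or written on the way.\<close>

inductive run :: "instr list \<Rightarrow> config \<Rightarrow> nat \<Rightarrow> nat set \<Rightarrow> config \<Rightarrow> bool"
  for prog :: "instr list" where
  refl: "run prog s 0 {} s"
| step: "pc < length prog \<Longrightarrow> exec (prog ! pc) (pc, m) = Some s \<Longrightarrow> run prog s t A s' \<Longrightarrow>
    run prog (pc, m) (Suc t) (accessed (prog ! pc) m \<union> A) s'"

text \<open>An algorithm consists of a program and the address \<open>base\<close> from which on its input is stored;
  all other cells initially contain 0. Execution starts with the first instruction and halts on
  reaching the end of the program; the output is then found in cell 0. The cells occupied by the
  input count towards the storage.\<close>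

definition initial_memory :: "nat \<Rightarrow> real list \<Rightarrow> memory" where
  "initial_memory base inp i =
     (if base \<le> i \<and> i < base + length inp then inp ! (i - base) else 0)"

definition computes ::
  "instr list \<times> nat \<Rightarrow> real list \<Rightarrow> real \<Rightarrow> nat \<Rightarrow> nat \<Rightarrow> bool" where
  "computes alg inp out work storage \<longleftrightarrow> (case alg of (prog, base) \<Rightarrow>
     \<exists>A m. run prog (0, initial_memory base inp) work A (length prog, m) \<and> m 0 = out \<and>
       storage = card (A \<union> {base ..< base + length inp}))"

text \<open>The list \<open>xs\<close> enumerates \<open>E\<close>. Each \<open>P\<^sub>x\<close> is given by its value and its gradient at \<open>x\<close>.\<close>

definition encode_field :: "nat \<Rightarrow> real vec list \<Rightarrow> (real vec \<Rightarrow> real vec \<Rightarrow> real) \<Rightarrow> real list" where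
  "encode_field d xs P = [real d, real (length xs)] @
     concat (map (\<lambda>x. list_of_vec x @ [P x x] @ list_of_vec (gradient d (P x) x)) xs)"

end

theory Submission
  imports Defs
begin

text \<open>
  The number to be computed is the maximum, over all pairs \<open>x \<noteq> y\<close> in \<open>E\<close>, of Le Gruyer's constant
  \<open>|A| + sqrt (A\<^sup>2 + B\<^sup>2)\<close> with \<open>A = (2 (P\<^sub>x(x) - P\<^sub>y(y)) + (\<nabla>P\<^sub>x + \<nabla>P\<^sub>y) \<bullet> (y - x)) / |x - y|\<^sup>2\<close> and
  \<open>B = |\<nabla>P\<^sub>x - \<nabla>P\<^sub>y| / |x - y|\<close> (theorem \<open>minimal_Lip_eqI\<close>), or \<open>0\<close> if there are no such pairs. There are
  at most \<open>N\<^sup>2\<close> pairs, and the constant of one pair costs \<open>O(d)\<close> operations, so that a double loop over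
  the input, which needs only a fixed number of further memory cells, has the required complexity.

  For \<open>M > 0\<close>, all these constants are at most \<open>M\<close> if and only if all pairs of data in \<open>E\<close> satisfy
  Wells's inequality
  \<open>f x \<le> f y + (G x + G y) \<bullet> (x - y) / 2 + M/4 |x - y|\<^sup>2 - |G x - G y|\<^sup>2 / (4 M)\<close>
  (lemma \<open>wells_iff_pair_const_le\<close>), so it remains to see that this inequality characterizes the
  1-fields that have an extension whose gradient has Lipschitz constant \<open>M\<close>.

  It is necessary: the Taylor bounds at \<open>x\<close> and at \<open>y\<close>, compared at a suitable third point, give it
  (lemma \<open>wells_necessary\<close>). It is sufficient on the whole space: if it holds for all pairs of points of
  \<open>\<real>\<^sup>d\<close>, then \<open>G\<close> is the gradient of \<open>f\<close> and has Lipschitz constant \<open>M\<close> (lemmas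
  \<open>wells_global_gradient\<close>, \<open>wells_global_lipschitz\<close>). The main point is therefore that data with
  Wells's inequality extend from \<open>E\<close> to the whole space with the inequality preserved (theorem
  \<open>wells_extension\<close>). The extension is
  \<open>F x = max\<^sub>q min\<^sub>z (f z + (G z + q) \<bullet> (x - z) / 2 + M/4 |x - z|\<^sup>2 - |q - G z|\<^sup>2 / (4 M))\<close>
  with \<open>z\<close> in \<open>E\<close> and \<open>q\<close> in \<open>\<real>\<^sup>d\<close>, and its gradient at \<open>x\<close> is the maximizer \<open>q\<close>, which exists and is
  unique because the minimum is strongly concave in \<open>q\<close>.
\<close>

section \<open>Euclidean vectors\<close>

lemma sprod_sum:
  fixes x y :: "real vec"
  assumes "x \<in> carrier_vec d" "y \<in> carrier_vec d"
  shows "x \<bullet> y = (\<Sum>i<d. x $ i * y $ i)"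
  using assms by (auto simp: scalar_prod_def atLeast0LessThan)

lemma sprod_self_nonneg [simp]: "v \<bullet> v \<ge> (0 :: real)"
  by (simp add: scalar_prod_def sum_nonneg)

lemma sprod_self_eq_0:
  fixes v :: "real vec"
  assumes "v \<in> carrier_vec d"
  shows "v \<bullet> v = 0 \<longleftrightarrow> v = 0\<^sub>v d"
  using assms by (auto simp: sprod_sum[where d = d] sum_nonneg_eq_0_iff)

lemma vnorm_sq: "vnorm v ^ 2 = v \<bullet> v"
  by (simp add: vnorm_def)

lemma vnorm_nonneg [simp]: "vnorm v \<ge> 0"
  by (simp add: vnorm_def)

lemma vnorm_smult: "v \<in> carrier_vec d \<Longrightarrow> vnorm (c \<cdot>\<^sub>v v) = \<bar>c\<bar> * vnorm v"
  by (simp add: vnorm_def real_sqrt_mult flip: power2_eq_square mult.assoc)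

lemma minus_eq_0_vec: "x \<in> carrier_vec d \<Longrightarrow> y \<in> carrier_vec d \<Longrightarrow> x - y = 0\<^sub>v d \<longleftrightarrow> x = y"
  for x y :: "real vec"
proof
  assume c: "x \<in> carrier_vec d" "y \<in> carrier_vec d" and *: "x - y = 0\<^sub>v d"
  have "(x - y) $ i = 0" if "i < d" for i using * that by simp
  then show "x = y" using c by (intro eq_vecI) auto
qed auto

lemma sprod_self_minus_pos:
  fixes x y :: "real vec"
  assumes "x \<in> carrier_vec d" "y \<in> carrier_vec d" "x \<noteq> y"
  shows "(x - y) \<bullet> (x - y) > 0"
proof -
  have "(x - y) \<bullet> (x - y) \<noteq> 0"
    using assms by (simp add: sprod_self_eq_0[where d = d] minus_eq_0_vec)
  then show ?thesis
    using sprod_self_nonneg[of "x - y"] by linarith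
qed

lemma abs_sprod_le:
  assumes "x \<in> carrier_vec d" "y \<in> carrier_vec d"
  shows "\<bar>x \<bullet> y\<bar> \<le> vnorm x * vnorm y"
proof -
  have "(y \<bullet> y) * ((y \<bullet> y) * (x \<bullet> x) - (x \<bullet> y)\<^sup>2)
      = ((y \<bullet> y) \<cdot>\<^sub>v x - (x \<bullet> y) \<cdot>\<^sub>v y) \<bullet> ((y \<bullet> y) \<cdot>\<^sub>v x - (x \<bullet> y) \<cdot>\<^sub>v y)"
    using assms comm_scalar_prod[OF assms]
    by (simp add: minus_scalar_prod_distrib[where n = d] scalar_prod_minus_distrib[where n = d]
        algebra_simps power2_eq_square)
  then have *: "0 \<le> (y \<bullet> y) * ((y \<bullet> y) * (x \<bullet> x) - (x \<bullet> y)\<^sup>2)"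
    by simp
  have "(x \<bullet> y)\<^sup>2 \<le> (x \<bullet> x) * (y \<bullet> y)"
  proof (cases "y \<bullet> y = 0")
    case True
    then show ?thesis using assms by (auto simp: sprod_self_eq_0[of y d])
  next
    case False
    then have "y \<bullet> y > 0"
      using sprod_self_nonneg[of y] by linarith
    then show ?thesis using * by (simp add: zero_le_mult_iff mult.commute)
  qed
  then have "(x \<bullet> y)\<^sup>2 \<le> (vnorm x * vnorm y)\<^sup>2"
    by (simp add: vnorm_sq power_mult_distrib)
  then have "\<bar>x \<bullet> y\<bar> \<le> \<bar>vnorm x * vnorm y\<bar>"
    by (simp only: abs_le_square_iff)
  then show ?thesis by simp
qed

section \<open>Gradients\<close>

lemma has_gradientE:
  assumes "has_gradient d F g x" "e > 0"
  obtains \<delta> where "\<delta> > 0" "\<And>y. y \<in> carrier_vec d \<Longrightarrow> vnorm (y - x) < \<delta> \<Longrightarrow>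
    \<bar>F y - F x - g \<bullet> (y - x)\<bar> \<le> e * vnorm (y - x)"
proof -
  have "\<exists>\<delta>>0. \<forall>y\<in>carrier_vec d. vnorm (y - x) < \<delta> \<longrightarrow>
     \<bar>F y - F x - g \<bullet> (y - x)\<bar> \<le> e * vnorm (y - x)"
    using assms unfolding has_gradient_def by simp
  then show thesis using that by blast
qed

lemma has_gradient_unique:
  assumes g: "has_gradient d F g x" and g': "has_gradient d F g' x" and x: "x \<in> carrier_vec d"
  shows "g = g'"
proof (rule ccontr)
  assume ne: "g \<noteq> g'"
  have c: "g \<in> carrier_vec d" "g' \<in> carrier_vec d"
    using g g' by (auto simp: has_gradient_def)
  define w where "w = g - g'"
  have w: "w \<in> carrier_vec d" using c by (simp add: w_def)
  define n where "n = vnorm w"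
  have n: "n > 0"
    using sprod_self_minus_pos[OF c ne] by (simp add: n_def w_def vnorm_def)
  obtain D1 where D1: "D1 > 0" "\<And>y. y \<in> carrier_vec d \<Longrightarrow> vnorm (y - x) < D1 \<Longrightarrow>
      \<bar>F y - F x - g \<bullet> (y - x)\<bar> \<le> n/4 * vnorm (y - x)"
    using has_gradientE[OF g, of "n/4"] n by auto
  obtain D2 where D2: "D2 > 0" "\<And>y. y \<in> carrier_vec d \<Longrightarrow> vnorm (y - x) < D2 \<Longrightarrow>
      \<bar>F y - F x - g' \<bullet> (y - x)\<bar> \<le> n/4 * vnorm (y - x)"
    using has_gradientE[OF g', of "n/4"] n by auto
  define t where "t = min D1 D2 / (2 * n)"
  have t: "t > 0" "t * n < D1" "t * n < D2"
    using n D1(1) D2(1) by (auto simp: t_def)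
  \<comment> \<open>along \<open>w\<close> the two linear parts differ by \<open>n\<close> times the length of the step,
    twice what both error bounds together allow\<close>
  define y where "y = x + t \<cdot>\<^sub>v w"
  have y: "y \<in> carrier_vec d" "y - x = t \<cdot>\<^sub>v w" using x w by (auto simp: y_def)
  have ny: "vnorm (y - x) = t * n" using t w y by (simp add: vnorm_smult n_def)
  have "g \<bullet> (y - x) - g' \<bullet> (y - x) = w \<bullet> (y - x)"
    using c y x by (simp add: w_def minus_scalar_prod_distrib[where n = d] algebra_simps)
  also have "\<dots> = t * n^2" using w by (simp add: y n_def vnorm_sq)
  finally have "t * n^2 \<le> n/4 * (t * n) + n/4 * (t * n)"
    using D1(2)[OF y(1), unfolded ny, OF t(2)] D2(2)[OF y(1), unfolded ny, OF t(3)]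
    unfolding abs_le_iff by linarith
  then show False using t n by (simp add: power2_eq_square)
qed

lemma gradient_eq: "has_gradient d F g x \<Longrightarrow> x \<in> carrier_vec d \<Longrightarrow> gradient d F x = g"
  unfolding gradient_def by (rule the_equality) (auto intro: has_gradient_unique)

lemma has_gradient_affine:
  assumes "a \<in> carrier_vec d" "\<forall>z\<in>carrier_vec d. p z = c + a \<bullet> z" "x \<in> carrier_vec d"
  shows "has_gradient d p a x"
proof -
  have "p y - p x - a \<bullet> (y - x) = 0" if "y \<in> carrier_vec d" for y
    using assms that by (simp add: scalar_prod_minus_distrib[where n = d])
  then show ?thesis using assms(1) by (auto simp: has_gradient_def intro!: exI[of _ 1])
qed

text \<open>Restriction to lines reduces the mean value arguments to functions of one real variable.\<close>

lemma DERIV_along_line: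
  assumes g: "has_gradient d F g (x + t \<cdot>\<^sub>v v)" and x: "x \<in> carrier_vec d" and v: "v \<in> carrier_vec d"
  shows "((\<lambda>t. F (x + t \<cdot>\<^sub>v v)) has_real_derivative g \<bullet> v) (at t)"
  unfolding DERIV_def LIM_eq
proof (intro allI impI)
  fix r :: real assume r: "0 < r"
  define e where "e = r / 2"
  have e: "e > 0" "e < r" using r by (auto simp: e_def)
  have c: "g \<in> carrier_vec d" using g by (auto simp: has_gradient_def)
  \<comment> \<open>\<open>1\<close> is added so that \<open>v = 0\<close> needs no separate treatment\<close>
  define n where "n = vnorm v + 1"
  have n: "n > 0" "vnorm v \<le> n" by (auto simp: n_def intro: add_nonneg_pos)
  obtain D where D: "D > 0" "\<And>y. y \<in> carrier_vec d \<Longrightarrow> vnorm (y - (x + t \<cdot>\<^sub>v v)) < D \<Longrightarrow>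
      \<bar>F y - F (x + t \<cdot>\<^sub>v v) - g \<bullet> (y - (x + t \<cdot>\<^sub>v v))\<bar> \<le> e/n * vnorm (y - (x + t \<cdot>\<^sub>v v))"
    using has_gradientE[OF g, of "e/n"] n e by auto
  have "norm ((F (x + (t + h) \<cdot>\<^sub>v v) - F (x + t \<cdot>\<^sub>v v)) / h - g \<bullet> v) < r"
    if h: "h \<noteq> 0" "\<bar>h\<bar> < D / n" for h
  proof -
    have eq: "(x + (t + h) \<cdot>\<^sub>v v) - (x + t \<cdot>\<^sub>v v) = h \<cdot>\<^sub>v v"
      using x v by (intro eq_vecI) (auto simp: algebra_simps)
    have nn: "vnorm (h \<cdot>\<^sub>v v) \<le> \<bar>h\<bar> * n"
      using n v by (simp add: vnorm_smult mult_left_mono)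
    also have "\<dots> < D" using h n by (simp add: field_simps)
    finally have "\<bar>F (x + (t + h) \<cdot>\<^sub>v v) - F (x + t \<cdot>\<^sub>v v) - g \<bullet> (h \<cdot>\<^sub>v v)\<bar> \<le> e/n * vnorm (h \<cdot>\<^sub>v v)"
      using D(2)[of "x + (t + h) \<cdot>\<^sub>v v"] x v unfolding eq by simp
    also have "\<dots> \<le> e/n * (\<bar>h\<bar> * n)"
      using nn n e by (intro mult_left_mono) auto
    also have "\<dots> = e * \<bar>h\<bar>" using n by simp
    also have "\<dots> < r * \<bar>h\<bar>" using e h by simp
    finally have *: "\<bar>F (x + (t + h) \<cdot>\<^sub>v v) - F (x + t \<cdot>\<^sub>v v) - h * (g \<bullet> v)\<bar> < r * \<bar>h\<bar>"
      using c v by simp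
    have "(F (x + (t + h) \<cdot>\<^sub>v v) - F (x + t \<cdot>\<^sub>v v)) / h - g \<bullet> v
      = (F (x + (t + h) \<cdot>\<^sub>v v) - F (x + t \<cdot>\<^sub>v v) - h * (g \<bullet> v)) / h"
      using h by (simp add: diff_divide_distrib)
    then show ?thesis using * h by (simp add: abs_divide pos_divide_less_eq)
  qed
  then show "\<exists>s>0. \<forall>h. h \<noteq> 0 \<and> norm (h - 0) < s \<longrightarrow>
     norm ((F (x + (t + h) \<cdot>\<^sub>v v) - F (x + t \<cdot>\<^sub>v v)) / h - g \<bullet> v) < r"
    using D(1) n by (intro exI[of _ "D/n"]) auto
qed

lemma Lip_gradient_leD:
  assumes "Lip d g \<le> ereal M" and x: "x \<in> carrier_vec d" and y: "y \<in> carrier_vec d"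
    and g: "g x \<in> carrier_vec d"
  shows "vnorm (g x - g y) \<le> M * vnorm (x - y)"
proof (cases "x = y")
  case True
  then show ?thesis using x y g by (simp add: vnorm_def)
next
  case False
  have "ereal (vnorm (g x - g y) / vnorm (x - y)) \<le> Lip d g"
    unfolding Lip_def using False x y by (intro SUP_upper2[of "(x, y)"]) auto
  then have "vnorm (g x - g y) / vnorm (x - y) \<le> M" using assms(1) by (metis ereal_less_eq(3) order_trans)
  moreover have "vnorm (x - y) > 0"
    using sprod_self_minus_pos[OF x y False] by (simp add: vnorm_def)
  ultimately show ?thesis by (simp add: field_simps)
qed

text \<open>Along the segment from \<open>x\<close> to \<open>z\<close> the derivative differs from its value at \<open>x\<close> by at most
  \<open>M t |z - x|\<^sup>2\<close>, so subtracting or adding the quadratic with that derivative gives a monotone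
  function.\<close>

lemma taylor_bound:
  assumes hg: "\<And>x. x \<in> carrier_vec d \<Longrightarrow> has_gradient d F (g x) x"
    and lip: "\<And>x y. x \<in> carrier_vec d \<Longrightarrow> y \<in> carrier_vec d \<Longrightarrow> vnorm (g x - g y) \<le> M * vnorm (x - y)"
    and x: "x \<in> carrier_vec d" and z: "z \<in> carrier_vec d"
  shows "\<bar>F z - F x - g x \<bullet> (z - x)\<bar> \<le> M / 2 * ((z - x) \<bullet> (z - x))"
proof -
  define v where "v = z - x"
  have v: "v \<in> carrier_vec d" using x z by (simp add: v_def)
  have zv: "z = x + 1 \<cdot>\<^sub>v v" "x = x + 0 \<cdot>\<^sub>v v" using x z by (auto simp: v_def)
  have gc: "g y \<in> carrier_vec d" if "y \<in> carrier_vec d" for y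
    using hg[OF that] by (simp add: has_gradient_def)
  define f where "f = (\<lambda>t. F (x + t \<cdot>\<^sub>v v))"
  have df: "(f has_real_derivative g (x + t \<cdot>\<^sub>v v) \<bullet> v) (at t)" for t
    unfolding f_def using x v by (intro DERIV_along_line[OF hg]) auto
  have bd: "\<bar>g (x + t \<cdot>\<^sub>v v) \<bullet> v - g x \<bullet> v\<bar> \<le> M * t * (v \<bullet> v)" if t: "t \<ge> 0" for t
  proof -
    have "\<bar>g (x + t \<cdot>\<^sub>v v) \<bullet> v - g x \<bullet> v\<bar> = \<bar>(g (x + t \<cdot>\<^sub>v v) - g x) \<bullet> v\<bar>"
      using x v by (simp add: minus_scalar_prod_distrib[where n = d] gc)
    also have "\<dots> \<le> vnorm (g (x + t \<cdot>\<^sub>v v) - g x) * vnorm v"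
      using x v by (intro abs_sprod_le[where d = d]) (auto simp: gc)
    also have "\<dots> \<le> M * vnorm (x + t \<cdot>\<^sub>v v - x) * vnorm v"
      using x v by (intro mult_right_mono lip) auto
    also have "x + t \<cdot>\<^sub>v v - x = t \<cdot>\<^sub>v v" using x v by auto
    also have "M * vnorm (t \<cdot>\<^sub>v v) * vnorm v = M * t * (v \<bullet> v)"
      using t v by (simp add: vnorm_smult power2_eq_square flip: vnorm_sq)
    finally show ?thesis .
  qed
  have "(f 1 - 1 * (g x \<bullet> v) - M/2 * 1^2 * (v \<bullet> v)) \<le> (f 0 - 0 * (g x \<bullet> v) - M/2 * 0^2 * (v \<bullet> v))"
  proof (rule DERIV_nonpos_imp_nonincreasing[where f = "\<lambda>t. f t - t * (g x \<bullet> v) - M/2 * t^2 * (v \<bullet> v)"], simp)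
    fix t :: real assume "0 \<le> t" "t \<le> 1"
    moreover have "((\<lambda>t. f t - t * (g x \<bullet> v) - M/2 * t^2 * (v \<bullet> v)) has_real_derivative
        g (x + t \<cdot>\<^sub>v v) \<bullet> v - g x \<bullet> v - M * t * (v \<bullet> v)) (at t)"
      by (auto intro!: derivative_eq_intros df)
    ultimately show "\<exists>y. ((\<lambda>t. f t - t * (g x \<bullet> v) - M/2 * t^2 * (v \<bullet> v)) has_real_derivative y) (at t) \<and> y \<le> 0"
      using bd[of t] by force
  qed
  moreover have "(f 1 - 1 * (g x \<bullet> v) + M/2 * 1^2 * (v \<bullet> v)) \<ge> (f 0 - 0 * (g x \<bullet> v) + M/2 * 0^2 * (v \<bullet> v))"
  proof (rule DERIV_nonneg_imp_nondecreasing[where f = "\<lambda>t. f t - t * (g x \<bullet> v) + M/2 * t^2 * (v \<bullet> v)"], simp)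
    fix t :: real assume "0 \<le> t" "t \<le> 1"
    moreover have "((\<lambda>t. f t - t * (g x \<bullet> v) + M/2 * t^2 * (v \<bullet> v)) has_real_derivative
        g (x + t \<cdot>\<^sub>v v) \<bullet> v - g x \<bullet> v + M * t * (v \<bullet> v)) (at t)"
      by (auto intro!: derivative_eq_intros df)
    ultimately show "\<exists>y. ((\<lambda>t. f t - t * (g x \<bullet> v) + M/2 * t^2 * (v \<bullet> v)) has_real_derivative y) (at t) \<and> y \<ge> 0"
      using bd[of t] by force
  qed
  moreover have "f 1 = F z" "f 0 = F x" using zv by (auto simp: f_def)
  ultimately have "F z - F x - g x \<bullet> v \<le> M/2 * (v \<bullet> v)" "- (M/2 * (v \<bullet> v)) \<le> F z - F x - g x \<bullet> v"
    by simp_all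
  then show ?thesis unfolding v_def by (intro abs_leI) linarith+
qed

section \<open>Wells's inequality\<close>

text \<open>
  The largest value at \<open>x\<close> that a function with gradient \<open>q\<close> at \<open>x\<close> can have, if its value and its
  gradient at \<open>y\<close> are \<open>a\<close> and \<open>p\<close> and its gradient has Lipschitz constant \<open>M\<close>.
\<close>

definition wells_bound :: "real \<Rightarrow> real vec \<Rightarrow> real \<Rightarrow> real vec \<Rightarrow> real vec \<Rightarrow> real vec \<Rightarrow> real" where
  "wells_bound M y a p x q = a + ((p + q) \<bullet> (x - y)) / 2 + M / 4 * ((x - y) \<bullet> (x - y))
     - ((q - p) \<bullet> (q - p)) / (4 * M)"

text \<open>
  Wells's inequality for the values \<open>f\<close> and the gradients \<open>G\<close>, in the direction from \<open>y\<close> to \<open>x\<close>.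
  It is not symmetric: compatibility of the data at two points means the inequality in both
  directions.
\<close>

definition wells :: "real \<Rightarrow> (real vec \<Rightarrow> real) \<Rightarrow> (real vec \<Rightarrow> real vec) \<Rightarrow> real vec \<Rightarrow> real vec \<Rightarrow> bool" where
  "wells M f G x y \<longleftrightarrow> f x \<le> wells_bound M y (f y) (G y) x (G x)"

text \<open>
  Moving the point from \<open>x\<close> to \<open>y\<close> and the gradient from \<open>q\<close> to \<open>q + M (x - y)\<close> changes the bound by an
  amount that does not depend on the datum at \<open>z\<close>. Hence the minimum of the bounds over many data
  changes by the same amount. Like the other quadratic identities below, this one holds in each
  coordinate.
\<close>

lemma wells_bound_shift:
  assumes "M > 0" "z \<in> carrier_vec d" "p \<in> carrier_vec d" "x \<in> carrier_vec d" "y \<in> carrier_vec d"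
    "q \<in> carrier_vec d"
  shows "wells_bound M z a p y (q + M \<cdot>\<^sub>v (x - y)) =
    wells_bound M z a p x q + q \<bullet> (y - x) - M / 2 * ((y - x) \<bullet> (y - x))"
proof -
  have "((p + (q + M \<cdot>\<^sub>v (x - y))) \<bullet> (y - z)) / 2 + M / 4 * ((y - z) \<bullet> (y - z))
     - ((q + M \<cdot>\<^sub>v (x - y) - p) \<bullet> (q + M \<cdot>\<^sub>v (x - y) - p)) / (4 * M)
     = ((p + q) \<bullet> (x - z)) / 2 + M / 4 * ((x - z) \<bullet> (x - z))
     - ((q - p) \<bullet> (q - p)) / (4 * M) + q \<bullet> (y - x) - M / 2 * ((y - x) \<bullet> (y - x))"
    using assms
    by (simp add: sprod_sum[where d = d] sum_distrib_left sum_divide_distrib flip: sum.distrib sum_subtractf)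
       (intro sum.cong, auto simp: field_simps)
  then show ?thesis unfolding wells_bound_def by simp
qed

lemma wells_bound_strongly_concave:
  assumes "M > 0" "z \<in> carrier_vec d" "p \<in> carrier_vec d" "x \<in> carrier_vec d"
    "q \<in> carrier_vec d" "r \<in> carrier_vec d"
  shows "wells_bound M z a p x (q + t \<cdot>\<^sub>v (r - q)) =
    (1 - t) * wells_bound M z a p x q + t * wells_bound M z a p x r
      + t * (1 - t) * ((r - q) \<bullet> (r - q)) / (4 * M)"
proof -
  have "((p + (q + t \<cdot>\<^sub>v (r - q))) \<bullet> (x - z)) / 2 + M / 4 * ((x - z) \<bullet> (x - z))
     - ((q + t \<cdot>\<^sub>v (r - q) - p) \<bullet> (q + t \<cdot>\<^sub>v (r - q) - p)) / (4 * M)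
     = (1 - t) * (((p + q) \<bullet> (x - z)) / 2 + M / 4 * ((x - z) \<bullet> (x - z)) - ((q - p) \<bullet> (q - p)) / (4 * M))
      + t * (((p + r) \<bullet> (x - z)) / 2 + M / 4 * ((x - z) \<bullet> (x - z)) - ((r - p) \<bullet> (r - p)) / (4 * M))
      + t * (1 - t) * ((r - q) \<bullet> (r - q)) / (4 * M)"
    using assms
    by (simp add: sprod_sum[where d = d] sum_distrib_left sum_divide_distrib flip: sum.distrib sum_subtractf)
       (intro sum.cong, auto simp: field_simps)
  then show ?thesis unfolding wells_bound_def by (simp add: algebra_simps)
qed

lemma wells_bound_le:
  assumes "M > 0" "z \<in> carrier_vec d" "p \<in> carrier_vec d" "x \<in> carrier_vec d"
    "q \<in> carrier_vec d"
  shows "wells_bound M z a p x q \<le> a + p \<bullet> (x - z) + M / 2 * ((x - z) \<bullet> (x - z))"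
proof -
  have "p \<bullet> (x - z) + M / 2 * ((x - z) \<bullet> (x - z))
     - (((p + q) \<bullet> (x - z)) / 2 + M / 4 * ((x - z) \<bullet> (x - z)) - ((q - p) \<bullet> (q - p)) / (4 * M))
     = ((q - p - M \<cdot>\<^sub>v (x - z)) \<bullet> (q - p - M \<cdot>\<^sub>v (x - z))) / (4 * M)"
    using assms
    by (simp add: sprod_sum[where d = d] sum_distrib_left sum_divide_distrib flip: sum.distrib sum_subtractf)
       (intro sum.cong, auto simp: field_simps)
  then have "p \<bullet> (x - z) + M / 2 * ((x - z) \<bullet> (x - z))
     - (((p + q) \<bullet> (x - z)) / 2 + M / 4 * ((x - z) \<bullet> (x - z)) - ((q - p) \<bullet> (q - p)) / (4 * M)) \<ge> 0"
    using assms(1) by simp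
  then show ?thesis unfolding wells_bound_def by linarith
qed

lemma wells_bound_tendsto:
  assumes "z \<in> carrier_vec d" "p \<in> carrier_vec d" "x \<in> carrier_vec d" "q \<in> carrier_vec d"
    and "\<And>n. r n \<in> carrier_vec d" "\<And>i. i < d \<Longrightarrow> (\<lambda>n. r n $ i) \<longlonglongrightarrow> q $ i"
  shows "(\<lambda>n. wells_bound M z a p x (r n)) \<longlonglongrightarrow> wells_bound M z a p x q"
proof -
  have dim: "dim_vec (r n) = d" for n using assms(5)[of n] by simp
  show ?thesis
    unfolding wells_bound_def divide_inverse using assms
    by (auto simp: sprod_sum[where d = d] dim cong: sum.cong intro!: tendsto_intros)
qed

text \<open>
  Both Taylor bounds are compared at the point \<open>z\<close> at which the upper quadratic at \<open>y\<close> and the lower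
  quadratic at \<open>x\<close> are closest to each other; it minimizes
  \<open>g y \<bullet> (z - y) - g x \<bullet> (z - x) + M/2 |z - y|\<^sup>2 + M/2 |z - x|\<^sup>2\<close>.
\<close>

lemma wells_necessary:
  assumes M: "M > 0"
    and hg: "\<And>x. x \<in> carrier_vec d \<Longrightarrow> has_gradient d F (g x) x"
    and lip: "\<And>x y. x \<in> carrier_vec d \<Longrightarrow> y \<in> carrier_vec d \<Longrightarrow> vnorm (g x - g y) \<le> M * vnorm (x - y)"
    and x: "x \<in> carrier_vec d" and y: "y \<in> carrier_vec d"
  shows "wells M F g x y"
proof -
  have c: "g x \<in> carrier_vec d" "g y \<in> carrier_vec d" using hg x y by (auto simp: has_gradient_def)
  define z where "z = (1/2) \<cdot>\<^sub>v (x + y) + (1 / (2 * M)) \<cdot>\<^sub>v (g x - g y)"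
  have z: "z \<in> carrier_vec d" using x y c by (simp add: z_def)
  have "F z - F x - g x \<bullet> (z - x) \<ge> - (M / 2 * ((z - x) \<bullet> (z - x)))"
    "F z - F y - g y \<bullet> (z - y) \<le> M / 2 * ((z - y) \<bullet> (z - y))"
    using taylor_bound[where g = g, OF hg lip x z] taylor_bound[where g = g, OF hg lip y z]
    unfolding abs_le_iff by linarith+
  then have "F x \<le> F y + (g y \<bullet> (z - y) - g x \<bullet> (z - x) + M / 2 * ((z - y) \<bullet> (z - y)) + M / 2 * ((z - x) \<bullet> (z - x)))"
    by linarith
  also have "g y \<bullet> (z - y) - g x \<bullet> (z - x) + M / 2 * ((z - y) \<bullet> (z - y)) + M / 2 * ((z - x) \<bullet> (z - x))
    = ((g y + g x) \<bullet> (x - y)) / 2 + M / 4 * ((x - y) \<bullet> (x - y)) - ((g x - g y) \<bullet> (g x - g y)) / (4 * M)"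
    using x y c z M
    by (simp add: sprod_sum[where d = d] sum_distrib_left sum_divide_distrib z_def flip: sum.distrib sum_subtractf)
       (intro sum.cong, auto simp: field_simps)
  finally show ?thesis by (simp add: wells_def wells_bound_def)
qed

text \<open>Adding the inequalities of both directions cancels the values and the mixed terms.\<close>

lemma wells_global_lipschitz:
  assumes M: "M > 0"
    and w: "wells M F g x y" "wells M F g y x"
    and c: "x \<in> carrier_vec d" "y \<in> carrier_vec d" "g x \<in> carrier_vec d" "g y \<in> carrier_vec d"
  shows "vnorm (g x - g y) \<le> M * vnorm (x - y)"
proof -
  have "F x + F y \<le> wells_bound M y (F y) (g y) x (g x) + wells_bound M x (F x) (g x) y (g y)"
    using w by (simp add: wells_def)
  moreover have "((g y + g x) \<bullet> (x - y)) / 2 + M / 4 * ((x - y) \<bullet> (x - y))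
     - ((g x - g y) \<bullet> (g x - g y)) / (4 * M) + (((g x + g y) \<bullet> (y - x)) / 2 + M / 4 * ((y - x) \<bullet> (y - x))
     - ((g y - g x) \<bullet> (g y - g x)) / (4 * M)) = M / 2 * ((x - y) \<bullet> (x - y)) - ((g x - g y) \<bullet> (g x - g y)) / (2 * M)"
    using M c
    by (simp add: sprod_sum[where d = d] sum_distrib_left sum_divide_distrib flip: sum.distrib sum_subtractf)
       (intro sum.cong, auto simp: field_simps)
  ultimately have "((g x - g y) \<bullet> (g x - g y)) / (2 * M) \<le> M / 2 * ((x - y) \<bullet> (x - y))"
    by (simp add: wells_bound_def)
  then have "(g x - g y) \<bullet> (g x - g y) \<le> M^2 * ((x - y) \<bullet> (x - y))"
    using M by (simp add: field_simps power2_eq_square)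
  then have "(vnorm (g x - g y))^2 \<le> (M * vnorm (x - y))^2"
    by (simp add: power_mult_distrib vnorm_sq)
  then show ?thesis by (rule power2_le_imp_le) (use M in simp)
qed

lemma wells_global_gradient:
  assumes M: "M > 0"
    and w: "\<And>x y. x \<in> carrier_vec d \<Longrightarrow> y \<in> carrier_vec d \<Longrightarrow> wells M F g x y"
    and g: "\<And>x. x \<in> carrier_vec d \<Longrightarrow> g x \<in> carrier_vec d" and x: "x \<in> carrier_vec d"
  shows "has_gradient d F (g x) x"
proof -
  have bd: "\<bar>F y - F x - g x \<bullet> (y - x)\<bar> \<le> M / 2 * (vnorm (y - x))^2" if y: "y \<in> carrier_vec d" for y
  proof -
    have "F y \<le> F x + g x \<bullet> (y - x) + M / 2 * ((y - x) \<bullet> (y - x))"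
      using w[OF y x] wells_bound_le[OF M x g[OF x] y g[OF y]] unfolding wells_def by (meson order_trans)
    moreover have "F x + g x \<bullet> (y - x) - M / 2 * ((y - x) \<bullet> (y - x)) \<le> F y"
    proof -
      have "F x \<le> F y + ((g y + g x) \<bullet> (x - y)) / 2 + M / 4 * ((x - y) \<bullet> (x - y))
        - ((g x - g y) \<bullet> (g x - g y)) / (4 * M)"
        using w[OF x y] by (simp add: wells_def wells_bound_def)
      moreover have "M / 2 * ((y - x) \<bullet> (y - x)) - (g x \<bullet> (y - x) + ((g y + g x) \<bullet> (x - y)) / 2
        + M / 4 * ((x - y) \<bullet> (x - y)) - ((g x - g y) \<bullet> (g x - g y)) / (4 * M))
        = ((g y - g x + M \<cdot>\<^sub>v (y - x)) \<bullet> (g y - g x + M \<cdot>\<^sub>v (y - x))) / (4 * M)"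
        using x y g[OF x] g[OF y] M
        by (simp add: sprod_sum[where d = d] sum_distrib_left sum_divide_distrib flip: sum.distrib sum_subtractf)
          (intro sum.cong, auto simp: field_simps)
      moreover have "\<dots> \<ge> 0" using M by simp
      ultimately show ?thesis by linarith
    qed
    ultimately show ?thesis unfolding vnorm_sq by (intro abs_leI) linarith+
  qed
  show ?thesis unfolding has_gradient_def
  proof (intro conjI allI impI g x)
    fix e :: real assume e: "e > 0"
    have "\<bar>F y - F x - g x \<bullet> (y - x)\<bar> \<le> e * vnorm (y - x)"
      if y: "y \<in> carrier_vec d" and s: "vnorm (y - x) < 2 * e / M" for y
    proof -
      have "M / 2 * (vnorm (y - x))^2 = (M / 2 * vnorm (y - x)) * vnorm (y - x)"
        by (simp add: power2_eq_square)
      also have "\<dots> \<le> e * vnorm (y - x)"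
        using s M by (intro mult_right_mono) (auto simp: field_simps)
      finally show ?thesis using bd[OF y] by linarith
    qed
    then show "\<exists>\<delta>>0. \<forall>y\<in>carrier_vec d. vnorm (y - x) < \<delta> \<longrightarrow>
        \<bar>F y - F x - g x \<bullet> (y - x)\<bar> \<le> e * vnorm (y - x)"
      using e M by (intro exI[of _ "2 * e / M"]) auto
  qed
qed

section \<open>Extension of 1-fields\<close>

lemma vec_Cauchy_convergent:
  fixes r :: "nat \<Rightarrow> real vec"
  assumes r: "\<And>n. r n \<in> carrier_vec d" and K: "K \<ge> 0"
    and cau: "\<And>m n N. N \<le> m \<Longrightarrow> N \<le> n \<Longrightarrow> (r m - r n) \<bullet> (r m - r n) \<le> K / real (Suc N)"
  obtains q where "q \<in> carrier_vec d" "\<And>i. i < d \<Longrightarrow> (\<lambda>n. r n $ i) \<longlonglongrightarrow> q $ i"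
proof -
  have "convergent (\<lambda>n. r n $ i)" if i: "i < d" for i
  proof (rule real_Cauchy_convergent, rule CauchyI)
    fix e :: real assume e: "e > 0"
    obtain N where N: "K / e^2 < real (Suc N)"
      using reals_Archimedean2[of "K / e^2"] by (metis less_Suc_eq of_nat_less_iff order_less_trans)
    have "norm (r m $ i - r n $ i) < e" if "m \<ge> N" "n \<ge> N" for m n
    proof -
      have "(r m $ i - r n $ i)\<^sup>2 = (r m - r n) $ i * (r m - r n) $ i"
        using i r[of m] r[of n] by (simp add: power2_eq_square)
      also have "\<dots> \<le> (\<Sum>j<d. (r m - r n) $ j * (r m - r n) $ j)"
        using i by (intro member_le_sum[where f = "\<lambda>j. (r m - r n) $ j * (r m - r n) $ j"]) auto
      also have "\<dots> = (r m - r n) \<bullet> (r m - r n)"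
        using r by (simp add: sprod_sum[where d = d])
      also have "\<dots> \<le> K / real (Suc N)" using cau that by blast
      also have "\<dots> < e^2" using N e by (simp add: field_simps)
      finally have "\<bar>r m $ i - r n $ i\<bar>^2 < e^2" by simp
      then show ?thesis using e by (metis less_eq_real_def power2_less_imp_less real_norm_def)
    qed
    then show "\<exists>N. \<forall>m\<ge>N. \<forall>n\<ge>N. norm (r m $ i - r n $ i) < e" by blast
  qed
  then show thesis
    by (intro that[of "vec d (\<lambda>i. lim (\<lambda>n. r n $ i))"]) (auto simp: convergent_LIMSEQ_iff)
qed

text \<open>
  The last assumption is sequential upper semicontinuity with respect to coordinatewise
  convergence. The conclusion is stronger than maximality: away from the maximizer, the function
  falls off at least quadratically.
\<close>

lemma strongly_concave_has_maximizer:
  fixes U :: "real vec \<Rightarrow> real"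
  assumes c: "c > 0"
    and conc: "\<And>q r t. q \<in> carrier_vec d \<Longrightarrow> r \<in> carrier_vec d \<Longrightarrow> 0 \<le> t \<Longrightarrow> t \<le> 1 \<Longrightarrow>
      (1 - t) * U q + t * U r + t * (1 - t) * c * ((r - q) \<bullet> (r - q)) \<le> U (q + t \<cdot>\<^sub>v (r - q))"
    and bdd: "\<And>q. q \<in> carrier_vec d \<Longrightarrow> U q \<le> K"
    and usc: "\<And>r q S. \<lbrakk>\<And>n. r n \<in> carrier_vec d; q \<in> carrier_vec d; \<And>i. i < d \<Longrightarrow> (\<lambda>n. r n $ i) \<longlonglongrightarrow> q $ i;
      \<And>n. S - 1 / real (Suc n) \<le> U (r n)\<rbrakk> \<Longrightarrow> S \<le> U q"
  obtains q where "q \<in> carrier_vec d"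
    "\<And>p. p \<in> carrier_vec d \<Longrightarrow> U p + c * ((p - q) \<bullet> (p - q)) \<le> U q"
proof -
  define S where "S = (SUP q\<in>carrier_vec d. U q)"
  have bd: "bdd_above (U ` carrier_vec d)" using bdd by (intro bdd_aboveI2)
  have S: "U q \<le> S" if "q \<in> carrier_vec d" for q
    unfolding S_def using that bd by (intro cSUP_upper)
  have "\<exists>q\<in>carrier_vec d. S - 1 / real (Suc n) \<le> U q" for n
  proof -
    have ne: "carrier_vec d \<noteq> ({} :: real vec set)" using zero_carrier_vec by blast
    have "S - 1 / real (Suc n) < S" by simp
    then show ?thesis
      using less_cSUP_iff[OF ne bd, of "S - 1 / real (Suc n)"] unfolding S_def by (meson less_imp_le)
  qed
  then obtain r where r: "\<And>n. r n \<in> carrier_vec d" "\<And>n. S - 1 / real (Suc n) \<le> U (r n)"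
    by metis
  \<comment> \<open>strong concavity at midpoints makes the maximizing sequence a Cauchy sequence\<close>
  obtain q where q: "q \<in> carrier_vec d" "\<And>i. i < d \<Longrightarrow> (\<lambda>n. r n $ i) \<longlonglongrightarrow> q $ i"
  proof (rule vec_Cauchy_convergent[of r d "4 / c"])
    fix m n N :: nat assume mn: "N \<le> m" "N \<le> n"
    have *: "S - 1 / real (Suc N) \<le> U (r k)" if "N \<le> k" for k
    proof -
      have "1 / real (Suc k) \<le> 1 / real (Suc N)" using that by (intro divide_left_mono) auto
      then show ?thesis using r(2)[of k] by linarith
    qed
    have "(1 - 1/2) * U (r n) + 1/2 * U (r m) + 1/2 * (1 - 1/2) * c * ((r m - r n) \<bullet> (r m - r n)) \<le> S"
    proof (rule order_trans[OF conc S])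
      show "r n + (1/2) \<cdot>\<^sub>v (r m - r n) \<in> carrier_vec d" using r(1) by simp
    qed (use r(1) in auto)
    then have "c * ((r m - r n) \<bullet> (r m - r n)) \<le> 4 * (1 / real (Suc N))"
      using *[OF mn(1)] *[OF mn(2)] by argo
    then have "(r m - r n) \<bullet> (r m - r n) \<le> 4 * (1 / real (Suc N)) / c"
      using c by (simp only: pos_le_divide_eq mult.commute)
    then show "(r m - r n) \<bullet> (r m - r n) \<le> 4 / c / real (Suc N)"
      by (simp only: divide_divide_eq_left mult.commute mult_1_right times_divide_eq_right)
  qed (use r c in auto)
  have Sq: "S \<le> U q" using usc[OF r(1) q r(2)] .
  show thesis
  proof (rule that[OF q(1)])
    fix p :: "real vec" assume p: "p \<in> carrier_vec d"
    \<comment> \<open>midpoints alone would lose a factor 2 in the constant, so the segment is divided at a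
      point \<open>t\<close> that tends to \<open>0\<close>\<close>
    have "(1 - t) * (c * ((p - q) \<bullet> (p - q))) \<le> U q - U p" if t: "0 < t" "t \<le> 1" for t
    proof -
      have "(1 - t) * U q + t * U p + t * (1 - t) * c * ((p - q) \<bullet> (p - q)) \<le> U (q + t \<cdot>\<^sub>v (p - q))"
        using conc[OF q(1) p] t by simp
      also have "\<dots> \<le> U q" using S[of "q + t \<cdot>\<^sub>v (p - q)"] Sq p q by simp
      finally have "t * ((1 - t) * (c * ((p - q) \<bullet> (p - q)))) \<le> t * (U q - U p)"
        by (simp add: algebra_simps)
      then show ?thesis using t by simp
    qed
    then have ev: "eventually (\<lambda>t. (1 - t) * (c * ((p - q) \<bullet> (p - q))) \<le> U q - U p) (at_right 0)"
      by (auto simp: eventually_at_right_field intro!: exI[of _ 1])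
    have "((\<lambda>t. (1 - t) * (c * ((p - q) \<bullet> (p - q)))) \<longlongrightarrow> (1 - 0) * (c * ((p - q) \<bullet> (p - q)))) (at_right (0::real))"
      by (intro tendsto_intros)
    from tendsto_upperbound[OF this ev] show "U p + c * ((p - q) \<bullet> (p - q)) \<le> U q" by simp
  qed
qed

text \<open>
  At every \<open>x\<close>, the new gradient \<open>g x\<close> maximizes \<open>U x q\<close>, the largest value that all data in \<open>E\<close> admit
  for a function with gradient \<open>q\<close> at \<open>x\<close>, and \<open>F x\<close> is the maximum. To compare two points \<open>x\<close> and
  \<open>y\<close>, the candidate \<open>g x + M (x - y)\<close> is inserted into \<open>U y\<close>; the quadratic fall-off from the
  maximum \<open>F y\<close> then is exactly what Wells's inequality needs.
\<close>

theorem wells_extension: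
  assumes M: "M > 0" and E: "finite E" "E \<noteq> {}" "E \<subseteq> carrier_vec d"
    and G: "\<And>x. x \<in> E \<Longrightarrow> G x \<in> carrier_vec d"
    and w: "\<And>x y. x \<in> E \<Longrightarrow> y \<in> E \<Longrightarrow> wells M f G x y"
  obtains F g where "\<And>x. x \<in> carrier_vec d \<Longrightarrow> g x \<in> carrier_vec d"
    "\<And>x y. x \<in> carrier_vec d \<Longrightarrow> y \<in> carrier_vec d \<Longrightarrow> wells M F g x y"
    "\<And>x. x \<in> E \<Longrightarrow> F x = f x \<and> g x = G x"
proof -
  define U where "U x q = (MIN z\<in>E. wells_bound M z (f z) (G z) x q)" for x q
  have Uge: "a \<le> U x q \<longleftrightarrow> (\<forall>z\<in>E. a \<le> wells_bound M z (f z) (G z) x q)" for a x q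
    unfolding U_def using E by (subst Min_ge_iff) auto
  have Ule: "U x q \<le> wells_bound M z (f z) (G z) x q" if "z \<in> E" for x q z
    using Uge[of "U x q"] that by blast
  have cE: "z \<in> carrier_vec d" if "z \<in> E" for z using E that by blast
  have ex: "\<exists>q\<in>carrier_vec d. \<forall>p\<in>carrier_vec d. U x p + 1 / (4 * M) * ((p - q) \<bullet> (p - q)) \<le> U x q"
    if x: "x \<in> carrier_vec d" for x
  proof -
    obtain z0 where z0: "z0 \<in> E" using E by blast
    show ?thesis
    proof (rule strongly_concave_has_maximizer[of "1 / (4 * M)" d "U x"])
      show "1 / (4 * M) > 0" using M by simp
    next
      fix q r :: "real vec" and t :: real
      assume q: "q \<in> carrier_vec d" and r: "r \<in> carrier_vec d" and t: "0 \<le> t" "t \<le> 1"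
      show "(1 - t) * U x q + t * U x r + t * (1 - t) * (1 / (4 * M)) * ((r - q) \<bullet> (r - q))
        \<le> U x (q + t \<cdot>\<^sub>v (r - q))"
        unfolding Uge
      proof
        fix z assume z: "z \<in> E"
        have "(1 - t) * U x q \<le> (1 - t) * wells_bound M z (f z) (G z) x q"
          "t * U x r \<le> t * wells_bound M z (f z) (G z) x r"
          using t Ule[OF z] by (auto intro!: mult_left_mono)
        then show "(1 - t) * U x q + t * U x r + t * (1 - t) * (1 / (4 * M)) * ((r - q) \<bullet> (r - q))
          \<le> wells_bound M z (f z) (G z) x (q + t \<cdot>\<^sub>v (r - q))"
          unfolding wells_bound_strongly_concave[OF M cE[OF z] G[OF z] x q r] by simp
      qed
    next
      fix q :: "real vec" assume q: "q \<in> carrier_vec d"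
      show "U x q \<le> f z0 + G z0 \<bullet> (x - z0) + M / 2 * ((x - z0) \<bullet> (x - z0))"
        using Ule[OF z0, of x q] wells_bound_le[OF M cE[OF z0] G[OF z0] x q, of "f z0"] by linarith
    next
      fix r :: "nat \<Rightarrow> real vec" and q S
      assume r: "\<And>n. r n \<in> carrier_vec d" and q: "q \<in> carrier_vec d"
        and lim: "\<And>i. i < d \<Longrightarrow> (\<lambda>n. r n $ i) \<longlonglongrightarrow> q $ i" and S: "\<And>n. S - 1 / real (Suc n) \<le> U x (r n)"
      show "S \<le> U x q" unfolding Uge
      proof
        fix z assume z: "z \<in> E"
        have l: "(\<lambda>n. S - 1 / real (Suc n)) \<longlonglongrightarrow> S - 0"
          by (intro tendsto_diff tendsto_const LIMSEQ_Suc[OF lim_1_over_n])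
        have "S - 0 \<le> wells_bound M z (f z) (G z) x q"
        proof (rule LIMSEQ_le[OF l wells_bound_tendsto[OF cE[OF z] G[OF z] x q r lim]])
          show "\<exists>N. \<forall>n\<ge>N. S - 1 / real (Suc n) \<le> wells_bound M z (f z) (G z) x (r n)"
            using order_trans[OF S Ule[OF z]] by blast
        qed
        then show "S \<le> wells_bound M z (f z) (G z) x q"
          by (simp only: diff_zero)
      qed
    next
      fix q :: "real vec"
      assume "q \<in> carrier_vec d"
        "\<And>p. p \<in> carrier_vec d \<Longrightarrow> U x p + 1 / (4 * M) * ((p - q) \<bullet> (p - q)) \<le> U x q"
      then show ?thesis by (intro bexI[of _ q] ballI)
    qed
  qed
  define g where "g x = (SOME q. q \<in> carrier_vec d \<and>
    (\<forall>p\<in>carrier_vec d. U x p + 1 / (4 * M) * ((p - q) \<bullet> (p - q)) \<le> U x q))" for x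
  have "g x \<in> carrier_vec d \<and>
    (\<forall>p\<in>carrier_vec d. U x p + 1 / (4 * M) * ((p - g x) \<bullet> (p - g x)) \<le> U x (g x))"
    if "x \<in> carrier_vec d" for x
    unfolding g_def by (rule someI_ex) (use ex[OF that] in blast)
  then have g: "\<And>x. x \<in> carrier_vec d \<Longrightarrow> g x \<in> carrier_vec d"
    and max: "\<And>x p. x \<in> carrier_vec d \<Longrightarrow> p \<in> carrier_vec d \<Longrightarrow>
      U x p + 1 / (4 * M) * ((p - g x) \<bullet> (p - g x)) \<le> U x (g x)"
    by blast+
  define F where "F x = U x (g x)" for x
  have shift: "U x q + q \<bullet> (y - x) - M / 2 * ((y - x) \<bullet> (y - x)) \<le> U y (q + M \<cdot>\<^sub>v (x - y))"
    if "x \<in> carrier_vec d" "y \<in> carrier_vec d" "q \<in> carrier_vec d" for x y q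
    unfolding Uge
  proof
    fix z assume z: "z \<in> E"
    show "U x q + q \<bullet> (y - x) - M / 2 * ((y - x) \<bullet> (y - x)) \<le> wells_bound M z (f z) (G z) y (q + M \<cdot>\<^sub>v (x - y))"
      using Ule[OF z, of x q] wells_bound_shift[OF M cE[OF z] G[OF z] that, of "f z"] by linarith
  qed
  show thesis
  proof (rule that[of g F, OF g])
    fix x y :: "real vec" assume x: "x \<in> carrier_vec d" and y: "y \<in> carrier_vec d"
    have q: "g x + M \<cdot>\<^sub>v (x - y) \<in> carrier_vec d" using x y g[OF x] by simp
    have "F x + g x \<bullet> (y - x) - M / 2 * ((y - x) \<bullet> (y - x)) +
      1 / (4 * M) * ((g x + M \<cdot>\<^sub>v (x - y) - g y) \<bullet> (g x + M \<cdot>\<^sub>v (x - y) - g y)) \<le> F y"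
      using shift[OF x y g[OF x]] max[OF y q] unfolding F_def by linarith
    moreover have "- (g x \<bullet> (y - x) - M / 2 * ((y - x) \<bullet> (y - x)) +
      1 / (4 * M) * ((g x + M \<cdot>\<^sub>v (x - y) - g y) \<bullet> (g x + M \<cdot>\<^sub>v (x - y) - g y))) =
      ((g y + g x) \<bullet> (x - y)) / 2 + M / 4 * ((x - y) \<bullet> (x - y)) - ((g x - g y) \<bullet> (g x - g y)) / (4 * M)"
      using x y g[OF x] g[OF y] M
      by (simp add: sprod_sum[where d = d] sum_distrib_left sum_divide_distrib
           flip: sum.distrib sum_subtractf sum_negf)
        (intro sum.cong, auto simp: field_simps)
    ultimately show "wells M F g x y" unfolding wells_def wells_bound_def by linarith
  next
    fix x assume x: "x \<in> E"
    note xc = cE[OF x]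
    have at: "wells_bound M x (f x) (G x) x q = f x - ((q - G x) \<bullet> (q - G x)) / (4 * M)"
      if q: "q \<in> carrier_vec d" for q
      using q xc G[OF x] by (simp add: wells_bound_def)
    have lo: "f x \<le> U x (G x)"
      unfolding Uge using w[OF x] by (simp add: wells_def)
    have "0 \<le> 1 / (4 * M) * ((G x - g x) \<bullet> (G x - g x))" using M by simp
    then have "f x \<le> U x (g x)" using max[OF xc G[OF x]] lo by linarith
    moreover define D where "D = (g x - G x) \<bullet> (g x - G x)"
    have "U x (g x) \<le> f x - D / (4 * M)"
      unfolding D_def using Ule[OF x, of x "g x"] unfolding at[OF g[OF xc]] .
    moreover have "D / (4 * M) \<ge> 0" using M by (simp add: D_def)
    ultimately have F: "U x (g x) = f x" and D: "D / (4 * M) = 0"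
      by linarith+
    from D M have "D = 0" by simp
    then have gx: "g x = G x"
      using sprod_self_minus_pos[OF g[OF xc] G[OF x]] unfolding D_def by (metis less_irrefl)
    show "F x = f x \<and> g x = G x"
      using gx F by (simp only: F_def)
  qed
qed

section \<open>The minimal Lipschitz constant\<close>

text \<open>
  Le Gruyer's constant \<open>|A| + sqrt (A\<^sup>2 + B\<^sup>2)\<close> of the data at two points, where
  \<open>A = (2 (f x - f y) + (G x + G y) \<bullet> (y - x)) / |x - y|\<^sup>2\<close> and \<open>B = |G x - G y| / |x - y|\<close>.
\<close>

definition pair_const :: "(real vec \<Rightarrow> real) \<Rightarrow> (real vec \<Rightarrow> real vec) \<Rightarrow> real vec \<Rightarrow> real vec \<Rightarrow> real" where
  "pair_const f G x y =
     (let s = (x - y) \<bullet> (x - y);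
          A = (2 * (f x - f y) + (G x + G y) \<bullet> (y - x)) / s
      in \<bar>A\<bar> + sqrt (A\<^sup>2 + ((G x - G y) \<bullet> (G x - G y)) / s))"

lemma abs_add_sqrt_le_iff:
  fixes A B M :: real
  assumes "M > 0" "B \<ge> 0"
  shows "\<bar>A\<bar> + sqrt (A\<^sup>2 + B) \<le> M \<longleftrightarrow> 2 * \<bar>A\<bar> * M + B \<le> M\<^sup>2"
proof
  assume "\<bar>A\<bar> + sqrt (A\<^sup>2 + B) \<le> M"
  then have "sqrt (A\<^sup>2 + B) \<le> M - \<bar>A\<bar>" by simp
  then have "sqrt (A\<^sup>2 + B) ^ 2 \<le> (M - \<bar>A\<bar>)^2"
    using assms by (intro power_mono) auto
  then show "2 * \<bar>A\<bar> * M + B \<le> M\<^sup>2"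
    using assms by (simp add: power2_diff algebra_simps)
next
  assume *: "2 * \<bar>A\<bar> * M + B \<le> M\<^sup>2"
  then have "\<bar>A\<bar> * 2 * M + B \<le> M * M" by (simp add: power2_eq_square mult.commute)
  then have "\<bar>A\<bar> * 2 * M \<le> M * M" using assms by linarith
  then have "\<bar>A\<bar> * 2 \<le> M" using assms(1) by (simp only: mult_le_cancel_right_pos)
  moreover have "A\<^sup>2 + B \<le> (M - \<bar>A\<bar>)^2"
    using * by (simp add: power2_diff algebra_simps)
  ultimately have "sqrt (A\<^sup>2 + B) \<le> M - \<bar>A\<bar>" by (intro real_le_lsqrt) auto
  then show "\<bar>A\<bar> + sqrt (A\<^sup>2 + B) \<le> M" by simp
qed

lemma wells_bound_iff:
  fixes s b A M :: real
  assumes "M > 0" "s > 0"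
  shows "A * s / 2 \<le> M / 4 * s - b / (4 * M) \<longleftrightarrow> 2 * A * M + b / s \<le> M\<^sup>2"
proof -
  have "A * s / 2 \<le> M / 4 * s - b / (4 * M) \<longleftrightarrow> (A * s / 2) * (4 * M / s) \<le> (M / 4 * s - b / (4 * M)) * (4 * M / s)"
    using assms by (subst mult_le_cancel_right_pos) auto
  also have "(A * s / 2) * (4 * M / s) = 2 * A * M" using assms by simp
  also have "(M / 4 * s - b / (4 * M)) * (4 * M / s) = M\<^sup>2 - b / s"
    using assms by (simp add: field_simps power2_eq_square)
  finally show ?thesis by linarith
qed

text \<open>After division by \<open>|x - y|\<^sup>2 / (4 M)\<close> the two inequalities become
  \<open>\<plusminus> 2 A M + B\<^sup>2 \<le> M\<^sup>2\<close>; the constant is the larger root of \<open>M\<^sup>2 - 2 |A| M - B\<^sup>2\<close>.\<close>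

lemma wells_iff_pair_const_le:
  assumes M: "M > 0" and c: "x \<in> carrier_vec d" "y \<in> carrier_vec d" "G x \<in> carrier_vec d" "G y \<in> carrier_vec d"
    and ne: "x \<noteq> y"
  shows "wells M f G x y \<and> wells M f G y x \<longleftrightarrow> pair_const f G x y \<le> M"
proof -
  define s where "s = (x - y) \<bullet> (x - y)"
  define b where "b = (G x - G y) \<bullet> (G x - G y)"
  define n where "n = 2 * (f x - f y) + (G x + G y) \<bullet> (y - x)"
  define A where "A = n / s"
  have s: "s > 0" unfolding s_def using sprod_self_minus_pos[OF c(1,2) ne] .
  have b: "b \<ge> 0" by (simp add: b_def)
  have eq: "A * s = n" using s by (simp add: A_def)
  have 1: "(G y + G x) \<bullet> (x - y) = - ((G x + G y) \<bullet> (y - x))"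
    "(G x + G y) \<bullet> (y - x) = (G x + G y) \<bullet> (y - x)"
    "(y - x) \<bullet> (y - x) = s" "(G y - G x) \<bullet> (G y - G x) = b"
    using c by (auto simp: sprod_sum[where d = d] s_def b_def algebra_simps simp flip: sum_negf intro!: sum.cong)
  have "wells M f G x y \<longleftrightarrow> A * s / 2 \<le> M / 4 * s - b / (4 * M)"
    unfolding wells_def wells_bound_def eq 1(1) n_def b_def[symmetric] s_def[symmetric] by argo
  moreover have "wells M f G y x \<longleftrightarrow> (- A) * s / 2 \<le> M / 4 * s - b / (4 * M)"
    unfolding wells_def wells_bound_def 1(3,4) mult_minus_left eq n_def by argo
  ultimately have "wells M f G x y \<and> wells M f G y x \<longleftrightarrow>
      2 * A * M + b / s \<le> M\<^sup>2 \<and> 2 * (- A) * M + b / s \<le> M\<^sup>2"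
    unfolding wells_bound_iff[OF M s] by blast
  also have "\<dots> \<longleftrightarrow> 2 * \<bar>A\<bar> * M + b / s \<le> M\<^sup>2"
  proof (cases "A \<ge> 0")
    case True
    then have "- A * M \<le> A * M" using M by (intro mult_right_mono) auto
    then show ?thesis using True by auto
  next
    case False
    then have "A * M \<le> - A * M" using M by (intro mult_right_mono) auto
    then show ?thesis using False by auto
  qed
  also have "\<dots> \<longleftrightarrow> pair_const f G x y \<le> M"
    using abs_add_sqrt_le_iff[of M "b / s" A] M b s
    by (simp add: pair_const_def Let_def s_def b_def A_def n_def)
  finally show ?thesis .
qed

lemma pair_const_nonneg: "pair_const f G x y \<ge> 0"
  by (simp add: pair_const_def Let_def)

lemma pair_const_commute:
  assumes "x \<in> carrier_vec d" "y \<in> carrier_vec d" "G x \<in> carrier_vec d" "G y \<in> carrier_vec d"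
  shows "pair_const f G x y = pair_const f G y x"
proof -
  have s: "(y - x) \<bullet> (y - x) = (x - y) \<bullet> (x - y)" "(G y - G x) \<bullet> (G y - G x) = (G x - G y) \<bullet> (G x - G y)"
   and n: "2 * (f y - f x) + (G y + G x) \<bullet> (x - y) = - (2 * (f x - f y) + (G x + G y) \<bullet> (y - x))"
    using assms by (auto simp: sprod_sum[where d = d] algebra_simps simp flip: sum_negf sum.distrib intro!: sum.cong)
  show ?thesis unfolding pair_const_def Let_def s n minus_divide_left[symmetric]
    by (simp only: abs_minus_cancel power2_minus)
qed

lemma affine_jet:
  assumes p: "affine_fun d p" and x: "x \<in> carrier_vec d"
  shows "gradient d p x \<in> carrier_vec d"
    and "z \<in> carrier_vec d \<Longrightarrow> p z = p x + gradient d p x \<bullet> (z - x)"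
proof -
  obtain c a where a: "a \<in> carrier_vec d" and p: "\<forall>z\<in>carrier_vec d. p z = c + a \<bullet> z"
    using p unfolding affine_fun_def by blast
  have g: "gradient d p x = a"
    by (rule gradient_eq[OF has_gradient_affine[OF a p x] x])
  show "gradient d p x \<in> carrier_vec d" using a g by simp
  show "z \<in> carrier_vec d \<Longrightarrow> p z = p x + gradient d p x \<bullet> (z - x)"
    using p x a by (simp add: g scalar_prod_minus_distrib[where n = d])
qed

lemma jet_eq_iff:
  assumes p: "affine_fun d p" and x: "x \<in> carrier_vec d" and g: "gradient d F x \<in> carrier_vec d"
  shows "(\<forall>z\<in>carrier_vec d. jet d F x z = p z) \<longleftrightarrow> F x = p x \<and> gradient d F x = gradient d p x"
proof
  assume *: "\<forall>z\<in>carrier_vec d. jet d F x z = p z"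
  have "jet d F x x = F x" using x g by (simp add: jet_def)
  then have 1: "F x = p x" using * x by simp
  have "\<forall>z\<in>carrier_vec d. p z = (F x - gradient d F x \<bullet> x) + gradient d F x \<bullet> z"
  proof
    fix z :: "real vec" assume z: "z \<in> carrier_vec d"
    have "p z = F x + gradient d F x \<bullet> (z - x)" using * z by (simp add: jet_def)
    then show "p z = (F x - gradient d F x \<bullet> x) + gradient d F x \<bullet> z"
      using x z g by (simp add: scalar_prod_minus_distrib[where n = d])
  qed
  from gradient_eq[OF has_gradient_affine[OF g this x] x] 1
  show "F x = p x \<and> gradient d F x = gradient d p x" by simp
next
  assume "F x = p x \<and> gradient d F x = gradient d p x"
  then show "\<forall>z\<in>carrier_vec d. jet d F x z = p z"
    using affine_jet(2)[OF p x] by (simp add: jet_def)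
qed

lemma Lip_nonneg:
  assumes "d \<ge> 1"
  shows "Lip d g \<ge> 0"
proof -
  have "(unit_vec d 0 :: real vec) $ 0 \<noteq> 0\<^sub>v d $ 0" using assms by simp
  then have ne: "unit_vec d 0 \<noteq> (0\<^sub>v d :: real vec)" by metis
  have "(0 :: ereal) \<le> ereal (vnorm (g (unit_vec d 0) - g (0\<^sub>v d)) / vnorm (unit_vec d 0 - 0\<^sub>v d))"
    by simp
  also have "\<dots> \<le> Lip d g"
    unfolding Lip_def using ne by (intro SUP_upper2[of "(unit_vec d 0, 0\<^sub>v d)"]) auto
  finally show ?thesis .
qed

lemma Lip_leI:
  assumes "\<And>x y. x \<in> carrier_vec d \<Longrightarrow> y \<in> carrier_vec d \<Longrightarrow> vnorm (g x - g y) \<le> M * vnorm (x - y)"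
  shows "Lip d g \<le> ereal M"
  unfolding Lip_def
proof (rule SUP_least, clarify)
  fix x y :: "real vec" assume *: "x \<in> carrier_vec d" "y \<in> carrier_vec d" "x \<noteq> y"
  have "vnorm (x - y) > 0" using sprod_self_minus_pos[OF *] by (simp add: vnorm_def)
  then show "ereal (vnorm (g x - g y) / vnorm (x - y)) \<le> ereal M"
    using assms[OF *(1,2)] by (simp add: pos_divide_le_eq)
qed

lemma C11_has_gradient:
  assumes "F \<in> C11 d" "x \<in> carrier_vec d"
  shows "has_gradient d F (gradient d F x) x"
proof -
  obtain g where "has_gradient d F g x" using assms unfolding C11_def by blast
  then show ?thesis using gradient_eq[OF _ assms(2)] by metis
qed

text \<open>Le Gruyer's constant of the 1-field \<open>P\<close> at two points.\<close>

abbreviation field_const :: "nat \<Rightarrow> (real vec \<Rightarrow> real vec \<Rightarrow> real) \<Rightarrow> real vec \<Rightarrow> real vec \<Rightarrow> real" where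
  "field_const d P \<equiv> pair_const (\<lambda>x. P x x) (\<lambda>x. gradient d (P x) x)"

lemma minimal_Lip_le:
  assumes M: "M > 0" and E: "finite E" "E \<subseteq> carrier_vec d" and P: "one_field d E P"
    and le: "\<And>x y. x \<in> E \<Longrightarrow> y \<in> E \<Longrightarrow> x \<noteq> y \<Longrightarrow> field_const d P x y \<le> M"
  shows "minimal_Lip d E P \<le> ereal M"
proof -
  define f where "f = (\<lambda>x. P x x)"
  define G where "G = (\<lambda>x. gradient d (P x) x)"
  have cE: "x \<in> carrier_vec d" if "x \<in> E" for x using E that by blast
  have aff: "affine_fun d (P x)" if "x \<in> E" for x using P that by (simp add: one_field_def)
  have G: "G x \<in> carrier_vec d" if "x \<in> E" for x
    unfolding G_def using affine_jet(1)[OF aff cE] that by blast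
  have w: "wells M f G x y" if "x \<in> E" "y \<in> E" for x y
  proof (cases "x = y")
    case True
    then show ?thesis using cE[OF that(1)] G[OF that(1)] by (simp add: wells_def wells_bound_def)
  next
    case False
    then show ?thesis
      using wells_iff_pair_const_le[where f = f and G = G, OF M cE cE G G False] le[OF that False] that
      by (simp add: f_def G_def)
  qed
  obtain F g where g: "\<And>x. x \<in> carrier_vec d \<Longrightarrow> g x \<in> carrier_vec d"
    and wF: "\<And>x y. x \<in> carrier_vec d \<Longrightarrow> y \<in> carrier_vec d \<Longrightarrow> wells M F g x y"
    and FE: "\<And>x. x \<in> E \<Longrightarrow> F x = f x \<and> g x = G x"
  proof (cases "E = {}")
    case True
    have "wells M (\<lambda>_. 0) (\<lambda>_. 0\<^sub>v d) x y" if "x \<in> carrier_vec d" "y \<in> carrier_vec d" for x y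
      using M that by (simp add: wells_def wells_bound_def)
    then show thesis using True by (intro that[of "\<lambda>_. 0\<^sub>v d" "\<lambda>_. 0"]) auto
  next
    case False
    show thesis
    proof (rule wells_extension[where f = f and G = G, OF M E(1) False E(2) G w])
      fix F g
      assume "\<And>x. x \<in> carrier_vec d \<Longrightarrow> g x \<in> carrier_vec d"
        "\<And>x y. x \<in> carrier_vec d \<Longrightarrow> y \<in> carrier_vec d \<Longrightarrow> wells M F g x y"
        "\<And>x. x \<in> E \<Longrightarrow> F x = f x \<and> g x = G x"
      then show thesis by (rule that)
    qed auto
  qed
  have hg: "has_gradient d F (g x) x" if "x \<in> carrier_vec d" for x
    by (rule wells_global_gradient[OF M wF g that])
  have gr: "gradient d F x = g x" if "x \<in> carrier_vec d" for x
    using gradient_eq[OF hg that] that by simp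
  have lip: "Lip d (gradient d F) \<le> ereal M"
    by (rule Lip_leI) (simp add: gr wells_global_lipschitz[OF M wF wF _ _ g g])
  then have "Lip d (gradient d F) < \<infinity>" by (meson ereal_less_PInfty less_ereal.simps(4) order_le_less_trans)
  then have "F \<in> C11 d" using hg by (auto simp: C11_def)
  moreover have "\<forall>z\<in>carrier_vec d. jet d F x z = P x z" if "x \<in> E" for x
    using jet_eq_iff[OF aff[OF that] cE[OF that], of F] gr[OF cE[OF that]] g[OF cE[OF that]] FE[OF that]
    by (simp add: f_def G_def)
  ultimately have "minimal_Lip d E P \<le> Lip d (gradient d F)"
    unfolding minimal_Lip_def by (intro INF_lower) auto
  then show ?thesis using lip by (rule order_trans)
qed

lemma le_minimal_Lip:
  assumes d: "d \<ge> 1" and E: "E \<subseteq> carrier_vec d" and P: "one_field d E P"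
    and xy: "x \<in> E" "y \<in> E" "x \<noteq> y"
  shows "ereal (field_const d P x y) \<le> minimal_Lip d E P"
  unfolding minimal_Lip_def
proof (rule INF_greatest, clarify)
  fix F assume F: "F \<in> C11 d" and jet: "\<forall>x\<in>E. \<forall>z\<in>carrier_vec d. jet d F x z = P x z"
  have cE: "x \<in> carrier_vec d" if "x \<in> E" for x using E that by blast
  have hg: "has_gradient d F (gradient d F x) x" if "x \<in> carrier_vec d" for x
    by (rule C11_has_gradient[OF F that])
  have gc: "gradient d F x \<in> carrier_vec d" if "x \<in> carrier_vec d" for x
    using hg[OF that] by (simp add: has_gradient_def)
  have FE: "F x = P x x \<and> gradient d F x = gradient d (P x) x" if "x \<in> E" for x
    using jet_eq_iff[OF _ cE[OF that] gc[OF cE[OF that]], of "P x"] jet P that by (simp add: one_field_def)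
  have "Lip d (gradient d F) < \<infinity>" using F by (simp add: C11_def)
  then obtain l where l: "Lip d (gradient d F) = ereal l" "l \<ge> 0"
    using Lip_nonneg[OF d, of "gradient d F"] by (cases "Lip d (gradient d F)") auto
  have "field_const d P x y \<le> l + e" if e: "e > 0" for e
  proof -
    have M: "l + e > 0" using l e by simp
    have "Lip d (gradient d F) \<le> ereal (l + e)" using l e by simp
    then have lip: "vnorm (gradient d F x - gradient d F y) \<le> (l + e) * vnorm (x - y)"
      if "x \<in> carrier_vec d" "y \<in> carrier_vec d" for x y
      using Lip_gradient_leD that gc by blast
    have "wells (l + e) F (gradient d F) x y \<and> wells (l + e) F (gradient d F) y x"
      using wells_necessary[where g = "gradient d F", OF M hg lip] xy cE by blast
    then have "pair_const F (gradient d F) x y \<le> l + e"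
      using wells_iff_pair_const_le[where f = F and G = "gradient d F", OF M _ _ gc gc xy(3)] xy cE by blast
    then show ?thesis using FE xy by (simp add: pair_const_def)
  qed
  then have "field_const d P x y \<le> l" by (rule field_le_epsilon)
  then show "ereal (field_const d P x y) \<le> Lip d (gradient d F)" using l by simp
qed

text \<open>
  The bounds are applied to all \<open>r + e\<close> with \<open>e > 0\<close>, because Wells's inequality divides by the Lipschitz
  constant and \<open>r\<close> may be \<open>0\<close>.
\<close>

theorem minimal_Lip_eqI:
  assumes d: "d \<ge> 1" and E: "finite E" "E \<subseteq> carrier_vec d" and P: "one_field d E P"
    and ub: "\<And>x y. x \<in> E \<Longrightarrow> y \<in> E \<Longrightarrow> x \<noteq> y \<Longrightarrow> field_const d P x y \<le> r"
    and attained: "r = 0 \<or> (\<exists>x\<in>E. \<exists>y\<in>E. x \<noteq> y \<and> r = field_const d P x y)"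
  shows "minimal_Lip d E P = ereal r"
proof (rule antisym)
  have "r \<ge> 0" using attained by (auto simp: pair_const_nonneg)
  show "minimal_Lip d E P \<le> ereal r"
  proof (rule ereal_le_epsilon2)
    fix e :: real assume e: "e > 0"
    have "minimal_Lip d E P \<le> ereal (r + e)"
      using e \<open>r \<ge> 0\<close> ub by (intro minimal_Lip_le[OF _ E P]) (auto intro: add_increasing2)
    then show "minimal_Lip d E P \<le> ereal r + ereal e" by simp
  qed
  have "0 \<le> minimal_Lip d E P"
    unfolding minimal_Lip_def by (intro INF_greatest Lip_nonneg[OF d])
  then show "ereal r \<le> minimal_Lip d E P"
    using attained le_minimal_Lip[OF d E(2) P] by (auto simp: zero_ereal_def)
qed

section \<open>The program and its execution\<close>

text \<open>
  The program for input that is stored from address 20 on. Cell 20 holds \<open>d\<close>, cell 21 the number of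
  points, and from cell 22 on there is one record of length \<open>2 d + 1\<close> for each point: its coordinates,
  the value, the coordinates of the gradient. Two nested loops run through all pairs of records in
  which the inner one precedes the outer one, and cell 0 accumulates the maximum of Le Gruyer's
  constants. Cell 6 is never written and serves as the constant 0; a branch with three equal targets
  is a jump.

  Cells 12, 13 and 14 add up \<open>|x - y|\<^sup>2\<close>, \<open>|G x - G y|\<^sup>2\<close> and \<open>(G x + G y) \<bullet> (y - x)\<close> for the outer point
  \<open>x\<close> and the inner point \<open>y\<close>.
\<close>

definition lip_program :: "instr list" where
  "lip_program = [
    \<comment> \<open>constant 1, address of the first record, record length and end of the input\<close>
    Const 1 1, Const 2 22, Arith Add 5 20 20, Arith Add 5 5 1, Arith Mul 4 5 21,
    Arith Add 4 4 2,
    \<comment> \<open>for all records at \<open>m[2]\<close>\<close>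
    Branch 2 4 7 55 55, Const 3 22,
    \<comment> \<open>for all records at \<open>m[3]\<close> before that one\<close>
    Branch 3 2 9 53 53,
    \<comment> \<open>addresses of the coordinates of the points and of the gradients, end of the point, empty sums\<close>
    Arith Add 7 2 6, Arith Add 8 3 6, Arith Add 11 2 20, Arith Add 9 11 1, Arith Add 10 3 20,
    Arith Add 10 10 1, Const 12 0, Const 13 0, Const 14 0,
    \<comment> \<open>add up the three sums over the coordinates\<close>
    Branch 7 11 19 37 37, Fetch 15 7, Fetch 16 8, Arith Sub 15 16 15, Arith Mul 16 15 15,
    Arith Add 12 12 16, Fetch 16 9, Fetch 17 10, Arith Add 19 16 17, Arith Mul 19 19 15,
    Arith Add 14 14 19, Arith Sub 16 16 17, Arith Mul 16 16 16, Arith Add 13 13 16,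
    Arith Add 7 7 1, Arith Add 8 8 1, Arith Add 9 9 1, Arith Add 10 10 1, Branch 6 6 18 18 18,
    \<comment> \<open>cells 7 and 8 now hold the addresses of the values; \<open>m[15] := A\<close>\<close>
    Fetch 15 7, Fetch 16 8, Arith Sub 15 15 16, Arith Add 15 15 15, Arith Add 15 15 14,
    Arith Div 15 15 12,
    \<comment> \<open>\<open>m[13] := sqrt (B\<^sup>2 + A\<^sup>2) + sqrt (A\<^sup>2)\<close>, where the second root is \<open>|A|\<close>\<close>
    Arith Mul 15 15 15, Arith Div 13 13 12, Arith Add 13 13 15, Sqrt 13 13, Sqrt 15 15,
    Arith Add 13 13 15,
    \<comment> \<open>\<open>m[0] := max m[0] m[13]\<close>\<close>
    Branch 0 13 50 51 51, Arith Add 0 13 6,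
    \<comment> \<open>next inner record\<close>
    Arith Add 3 3 5, Branch 6 6 8 8 8,
    \<comment> \<open>next outer record\<close>
    Arith Add 2 2 5, Branch 6 6 6 6 6]"

lemma length_lip_program: "length lip_program = 55"
  by (simp add: lip_program_def)

text \<open>
  Execution of exactly \<open>n\<close> steps that access only addresses in \<open>B\<close>, as a function: on a straight-line
  piece of code the simplifier computes its result.
\<close>

fun srun :: "nat set \<Rightarrow> nat \<Rightarrow> config \<Rightarrow> config option" where
  "srun B 0 s = Some s"
| "srun B (Suc n) (pc, m) = (if pc < length lip_program \<and> accessed (lip_program ! pc) m \<subseteq> B
     then Option.bind (exec (lip_program ! pc) (pc, m)) (srun B n) else None)"

lemma srun_numeral: "srun B (numeral k) (pc, m) = (if pc < length lip_program \<and> accessed (lip_program ! pc) m \<subseteq> B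
     then Option.bind (exec (lip_program ! pc) (pc, m)) (srun B (pred_numeral k)) else None)"
  by (simp add: numeral_eq_Suc)

text \<open>
  Within \<open>T\<close> steps, and accessing only addresses in \<open>B\<close>, the program reaches a configuration with
  property \<open>Q\<close>.
\<close>

definition reach :: "nat set \<Rightarrow> nat \<Rightarrow> config \<Rightarrow> (config \<Rightarrow> bool) \<Rightarrow> bool" where
  "reach B T s Q \<longleftrightarrow> (\<exists>t A s'. t \<le> T \<and> A \<subseteq> B \<and> run lip_program s t A s' \<and> Q s')"

lemma run_trans: "run p s t A s' \<Longrightarrow> run p s' t' A' s'' \<Longrightarrow> run p s (t + t') (A \<union> A') s''"
proof (induction rule: run.induct)
  case (step pc m s t A s')
  then show ?case using run.step[OF step.hyps(1,2) step.IH[OF step.prems]] by (simp add: Un_assoc)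
qed simp

lemma srun_run: "srun B n s = Some s' \<Longrightarrow> \<exists>A. A \<subseteq> B \<and> run lip_program s n A s'"
proof (induction n arbitrary: s)
  case 0
  then have "s = s'" by simp
  then show ?case by (intro exI[of _ "{}"]) (simp add: run.refl)
next
  case (Suc n)
  obtain pc m where s: "s = (pc, m)" by force
  have c: "pc < length lip_program \<and> accessed (lip_program ! pc) m \<subseteq> B"
  proof (rule ccontr)
    assume "\<not> (pc < length lip_program \<and> accessed (lip_program ! pc) m \<subseteq> B)"
    then show False using Suc.prems by (simp only: s srun.simps if_False option.distinct)
  qed
  have e: "Option.bind (exec (lip_program ! pc) (pc, m)) (srun B n) = Some s'"
    using Suc.prems by (simp only: s srun.simps c if_True simp_thms)
  obtain s1 where s1: "exec (lip_program ! pc) (pc, m) = Some s1" "srun B n s1 = Some s'"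
    using e unfolding bind_eq_Some_conv by blast
  obtain A where A: "A \<subseteq> B" "run lip_program s1 n A s'" using Suc.IH[OF s1(2)] by blast
  show ?case unfolding s
    using run.step[OF conjunct1[OF c] s1(1) A(2)] conjunct2[OF c] A(1)
    by (intro exI[of _ "accessed (lip_program ! pc) m \<union> A"]) simp
qed

lemma srun_add: "srun B n s = Some s' \<Longrightarrow> srun B n' s' = Some s'' \<Longrightarrow> srun B (n + n') s = Some s''"
proof (induction n arbitrary: s)
  case (Suc n)
  then show ?case by (cases s) (auto simp: bind_eq_Some_conv split: if_splits)
qed simp

lemma reach_refl: "Q s \<Longrightarrow> reach B T s Q"
  unfolding reach_def using run.refl by (intro exI[of _ 0] exI[of _ "{}"] exI[of _ s]) simp

lemma reach_srun: "srun B n s = Some s' \<Longrightarrow> reach B T s' Q \<Longrightarrow> reach B (n + T) s Q"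
proof -
  assume "srun B n s = Some s'" "reach B T s' Q"
  then obtain A t A' s'' where *: "A \<subseteq> B" "run lip_program s n A s'" "t \<le> T" "A' \<subseteq> B" "run lip_program s' t A' s''" "Q s''"
    using srun_run unfolding reach_def by metis
  show ?thesis unfolding reach_def
    using run_trans[OF *(2,5)] * by (intro exI[of _ "n + t"] exI[of _ "A \<union> A'"] exI[of _ s'']) simp
qed

lemma reach_trans: "reach B T s R \<Longrightarrow> (\<And>s'. R s' \<Longrightarrow> reach B T' s' Q) \<Longrightarrow> reach B (T + T') s Q"
proof -
  assume 1: "reach B T s R" and 2: "\<And>s'. R s' \<Longrightarrow> reach B T' s' Q"
  obtain t A s1 where a: "t \<le> T" "A \<subseteq> B" "run lip_program s t A s1" "R s1"
    using 1 unfolding reach_def by blast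
  obtain t' A' s2 where b: "t' \<le> T'" "A' \<subseteq> B" "run lip_program s1 t' A' s2" "Q s2"
    using 2[OF a(4)] unfolding reach_def by blast
  show ?thesis unfolding reach_def
    using run_trans[OF a(3) b(3)] a b by (intro exI[of _ "t + t'"] exI[of _ "A \<union> A'"] exI[of _ s2]) simp
qed

lemma reach_mono: "reach B T s Q \<Longrightarrow> T \<le> T' \<Longrightarrow> (\<And>s. Q s \<Longrightarrow> R s) \<Longrightarrow> reach B T' s R"
  unfolding reach_def by (meson order_trans)

lemma address_of_nat [simp]: "address (real n) = Some n"
  by (simp add: address_def)

lemmas srun_simps = srun_numeral length_lip_program lip_program_def

section \<open>Loop invariants\<close>

text \<open>
  \<open>I\<close> is the memory at the start, of which only the input part, from address 20 on, matters. The
  length of a record is \<open>s\<close>, and \<open>K\<close> is the first address behind the input.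
\<close>

locale layout =
  fixes I :: memory and d N :: nat
  assumes I_d: "I 20 = real d" and I_N: "I 21 = real N"
begin

definition s :: nat where "s = 2 * d + 1"
definition K :: nat where "K = 22 + N * s"

text \<open>What all parts of the program after the initialization preserve.\<close>

definition frame :: "memory \<Rightarrow> bool" where
  "frame m \<longleftrightarrow> (\<forall>i\<ge>20. m i = I i) \<and> m 1 = 1 \<and> m 4 = real K \<and> m 5 = real s \<and> m 6 = 0"

text \<open>The sums over the first \<open>k\<close> coordinates, for the records at \<open>p\<close> (outer) and at \<open>q\<close> (inner).\<close>

definition sumS :: "nat \<Rightarrow> nat \<Rightarrow> nat \<Rightarrow> real" where
  "sumS p q k = (\<Sum>i<k. (I (q + i) - I (p + i)) * (I (q + i) - I (p + i)))"

definition sumT :: "nat \<Rightarrow> nat \<Rightarrow> nat \<Rightarrow> real" where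
  "sumT p q k = (\<Sum>i<k. (I (p + d + 1 + i) - I (q + d + 1 + i)) * (I (p + d + 1 + i) - I (q + d + 1 + i)))"

definition sumW :: "nat \<Rightarrow> nat \<Rightarrow> nat \<Rightarrow> real" where
  "sumW p q k = (\<Sum>i<k. (I (p + d + 1 + i) + I (q + d + 1 + i)) * (I (q + i) - I (p + i)))"

text \<open>Holds at instruction 8, the head of the loop over the inner records; \<open>r\<close> is the maximum so far.\<close>

definition inner_inv :: "nat \<Rightarrow> nat \<Rightarrow> real \<Rightarrow> memory \<Rightarrow> bool" where
  "inner_inv p q r m \<longleftrightarrow> frame m \<and> m 0 = r \<and> m 2 = real p \<and> m 3 = real q"

text \<open>Holds at instruction 18, the head of the loop over the coordinates.\<close>

definition coord_inv :: "nat \<Rightarrow> nat \<Rightarrow> real \<Rightarrow> nat \<Rightarrow> memory \<Rightarrow> bool" where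
  "coord_inv p q r k m \<longleftrightarrow> inner_inv p q r m \<and> m 7 = real (p + k) \<and> m 8 = real (q + k) \<and>
     m 9 = real (p + d + 1 + k) \<and> m 10 = real (q + d + 1 + k) \<and> m 11 = real (p + d) \<and>
     m 12 = sumS p q k \<and> m 13 = sumT p q k \<and> m 14 = sumW p q k"

lemma coord_step:
  assumes inv: "coord_inv p q r k m" and k: "k < d" and p: "22 \<le> p" "p + s \<le> K" and q: "22 \<le> q" "q + s \<le> K"
  shows "\<exists>m'. srun {..<K} 19 (18, m) = Some (18, m') \<and> coord_inv p q r (Suc k) m'"
proof -
  have lt: "p + k < K" "q + k < K" "p + d + 1 + k < K" "q + d + 1 + k < K"  "22 \<le> K"
    using p q k by (auto simp: s_def)
  have ne: "x \<ge> 22 \<Longrightarrow> m x = I x" for x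
    using inv by (auto simp: coord_inv_def inner_inv_def frame_def)
  note I = ne[of "p + k"] ne[of "q + k"] ne[of "p + d + 1 + k"] ne[of "q + d + 1 + k"]
  show ?thesis
    using inv lt k p(1) q(1) I
    by (simp add: srun_simps coord_inv_def inner_inv_def frame_def sumS_def sumT_def sumW_def
        del: of_nat_add of_nat_Suc)
qed

lemma coord_loop:
  assumes p: "22 \<le> p" "p + s \<le> K" and q: "22 \<le> q" "q + s \<le> K"
  shows "coord_inv p q r k m \<Longrightarrow> k \<le> d \<Longrightarrow>
    reach {..<K} (19 * (d - k)) (18, m) (\<lambda>(pc, m'). pc = 18 \<and> coord_inv p q r d m')"
proof (induction "d - k" arbitrary: k m)
  case 0
  then show ?case by (intro reach_refl) auto
next
  case (Suc n)
  then have k: "k < d" by simp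
  obtain m1 where m1: "srun {..<K} 19 (18, m) = Some (18, m1)" "coord_inv p q r (Suc k) m1"
    using coord_step[OF Suc.prems(1) k p q] by blast
  have "reach {..<K} (19 * (d - Suc k)) (18, m1) (\<lambda>(pc, m'). pc = 18 \<and> coord_inv p q r d m')"
    using Suc m1(2) k by auto
  from reach_srun[OF m1(1) this] show ?case
    using k by (rule_tac reach_mono) auto
qed

lemma coord_init:
  assumes "inner_inv p q r m" and p: "22 \<le> p" "p + s \<le> K" and q: "22 \<le> q" "q + s \<le> K"
  shows "\<exists>m'. srun {..<K} 9 (9, m) = Some (18, m') \<and> coord_inv p q r 0 m'"
proof -
  have "22 \<le> K" using p by simp
  moreover have "m 20 = real d" using assms(1) I_d by (simp add: inner_inv_def frame_def)
  ultimately show ?thesis using assms(1)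
    by (simp add: srun_simps coord_inv_def inner_inv_def frame_def sumS_def sumT_def sumW_def)
qed

text \<open>The number \<open>A\<close> of Le Gruyer's formula, and the constant, in terms of the memory contents.\<close>

definition slope :: "nat \<Rightarrow> nat \<Rightarrow> real" where
  "slope p q = (2 * (I (p + d) - I (q + d)) + sumW p q d) / sumS p q d"

definition cval :: "nat \<Rightarrow> nat \<Rightarrow> real" where
  "cval p q = \<bar>slope p q\<bar> + sqrt ((slope p q)\<^sup>2 + sumT p q d / sumS p q d)"

lemma sumS_nonneg: "sumS p q k \<ge> 0" and sumT_nonneg: "sumT p q k \<ge> 0"
  by (auto simp: sumS_def sumT_def intro!: sum_nonneg)

lemma pair_value:
  assumes inv: "coord_inv p q r d m" and p: "22 \<le> p" "p + s \<le> K" and q: "22 \<le> q" "q + s \<le> K"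
    and ne: "sumS p q d \<noteq> 0"
  shows "\<exists>m'. srun {..<K} 13 (18, m) = Some (49, m') \<and> inner_inv p q r m' \<and> m' 13 = cval p q"
proof -
  have lt: "p + d < K" "q + d < K" "22 \<le> K"
    using p q by (auto simp: s_def)
  have "m x = I x" if "x \<ge> 22" for x
    using inv that by (auto simp: coord_inv_def inner_inv_def frame_def)
  then have I: "m (p + d) = I (p + d)" "m (q + d) = I (q + d)" using p q by auto
  have "q + d \<noteq> 15" using q by simp
  then obtain m1 where m1: "srun {..<K} 7 (18, m) = Some (43, m1)" "inner_inv p q r m1"
      "m1 15 = slope p q" "m1 12 = sumS p q d" "m1 13 = sumT p q d"
    using inv lt I ne
    by (simp add: srun_simps coord_inv_def inner_inv_def frame_def slope_def del: of_nat_add of_nat_Suc)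
  have nn: "\<not> sumT p q d / sumS p q d + slope p q * slope p q < 0"
    using sumS_nonneg[of p q d] sumT_nonneg[of p q d] by (simp add: not_less)
  have sq: "\<not> slope p q * slope p q < 0" by (simp add: not_less)
  have "\<exists>m'. srun {..<K} 6 (43, m1) = Some (49, m') \<and> inner_inv p q r m' \<and> m' 13 = cval p q"
    using m1(2-) lt ne nn sq
    by (simp add: srun_simps inner_inv_def frame_def cval_def power2_eq_square add.commute del: mult_less_0_iff)
  then obtain m2 where m2: "srun {..<K} 6 (43, m1) = Some (49, m2)" "inner_inv p q r m2" "m2 13 = cval p q"
    by blast
  show ?thesis using srun_add[OF m1(1) m2(1)] m2(2,3) by auto
qed

lemma pair_update:
  assumes inv: "inner_inv p q r m" and v: "m 13 = c" and K: "22 \<le> K"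
  shows "reach {..<K} 4 (49, m) (\<lambda>(pc, m'). pc = 8 \<and> inner_inv p (q + s) (max r c) m')"
proof (cases "r < c")
  case True
  then have "\<exists>m'. srun {..<K} 4 (49, m) = Some (8, m') \<and> inner_inv p (q + s) (max r c) m'"
    using inv v K by (simp add: srun_simps inner_inv_def frame_def)
  then show ?thesis using reach_srun[of _ 4 _ _ 0] reach_refl by fastforce
next
  case False
  then have "\<exists>m'. srun {..<K} 3 (49, m) = Some (8, m') \<and> inner_inv p (q + s) (max r c) m'"
    using inv v K by (simp add: srun_simps inner_inv_def frame_def)
  then show ?thesis using reach_srun[of _ 3 _ _ 1] reach_refl by fastforce
qed

text \<open>The address of record \<open>i\<close>.\<close>

definition addr :: "nat \<Rightarrow> nat" where
  "addr i = 22 + i * s"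

lemma addr_ge: "22 \<le> addr i"
  by (simp add: addr_def)

lemma addr_Suc: "addr (Suc i) = addr i + s"
  by (simp add: addr_def)

lemma addr_less_iff [simp]: "addr i < addr j \<longleftrightarrow> i < j"
proof -
  have "s > 0" by (simp add: s_def)
  then show ?thesis by (simp add: addr_def)
qed

lemma addr_N: "addr N = K"
  by (simp add: addr_def K_def)

lemma addr_le: "i < N \<Longrightarrow> addr i + s \<le> K"
  using addr_less_iff[of N "Suc i"] by (simp add: addr_Suc addr_N flip: not_less)

lemma K_ge: "22 \<le> K"
  by (simp add: K_def)

text \<open>The maxima that the inner and the outer loop compute.\<close>

primrec row_max :: "real \<Rightarrow> nat \<Rightarrow> nat \<Rightarrow> real" where
  "row_max r i 0 = r"
| "row_max r i (Suc j) = max (row_max r i j) (cval (addr i) (addr j))"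

primrec total_max :: "nat \<Rightarrow> real" where
  "total_max 0 = 0"
| "total_max (Suc i) = row_max (total_max i) i i"

lemma pair_body:
  assumes inv: "inner_inv p q r m" and p: "22 \<le> p" "p + s \<le> K" and q: "22 \<le> q" "q + s \<le> K"
    and ne: "sumS p q d \<noteq> 0"
  shows "reach {..<K} (19 * d + 26) (9, m) (\<lambda>(pc, m'). pc = 8 \<and> inner_inv p (q + s) (max r (cval p q)) m')"
proof -
  obtain m1 where m1: "srun {..<K} 9 (9, m) = Some (18, m1)" "coord_inv p q r 0 m1"
    using coord_init[OF inv p q] by blast
  have "reach {..<K} (19 * d + 17) (18, m1) (\<lambda>(pc, m'). pc = 8 \<and> inner_inv p (q + s) (max r (cval p q)) m')"
  proof (rule reach_trans)
    show "reach {..<K} (19 * d) (18, m1) (\<lambda>(pc, m'). pc = 18 \<and> coord_inv p q r d m')"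
      using coord_loop[OF p q m1(2)] by simp
  next
    fix c :: config assume "case c of (pc, m') \<Rightarrow> pc = 18 \<and> coord_inv p q r d m'"
    then obtain m2 where c: "c = (18, m2)" and inv: "coord_inv p q r d m2" by (cases c) auto
    obtain m3 where m3: "srun {..<K} 13 (18, m2) = Some (49, m3)" "inner_inv p q r m3" "m3 13 = cval p q"
      using pair_value[OF inv p q ne] by blast
    show "reach {..<K} 17 c (\<lambda>(pc, m'). pc = 8 \<and> inner_inv p (q + s) (max r (cval p q)) m')"
      using reach_srun[OF m3(1) pair_update[OF m3(2,3) K_ge]] unfolding c by simp
  qed
  from reach_srun[OF m1(1) this] show ?thesis by (rule reach_mono) auto
qed

end

text \<open>The assumption excludes divisions by zero; distinct points satisfy it.\<close>

locale separated_layout = layout +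
  assumes sep: "i < N \<Longrightarrow> j < i \<Longrightarrow> sumS (addr i) (addr j) d \<noteq> 0"
begin

lemma inner_loop:
  "inner_inv (addr i) (addr j) (row_max r i j) m \<Longrightarrow> j \<le> i \<Longrightarrow> i < N \<Longrightarrow>
    reach {..<K} ((19 * d + 27) * (i - j)) (8, m)
      (\<lambda>(pc, m'). pc = 8 \<and> inner_inv (addr i) (addr i) (row_max r i i) m')"
proof (induction "i - j" arbitrary: j m)
  case 0
  then show ?case by (intro reach_refl) auto
next
  case (Suc n)
  then have j: "j < i" "j < N" by auto
  have 1: "srun {..<K} 1 (8, m) = Some (9, m)"
    using Suc.prems(1) j(1) K_ge by (simp add: srun_simps inner_inv_def)
  have "reach {..<K} ((19 * d + 26) + (19 * d + 27) * (i - Suc j)) (9, m)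
      (\<lambda>(pc, m'). pc = 8 \<and> inner_inv (addr i) (addr i) (row_max r i i) m')"
  proof (rule reach_trans)
    show "reach {..<K} (19 * d + 26) (9, m)
        (\<lambda>(pc, m'). pc = 8 \<and> inner_inv (addr i) (addr j + s) (max (row_max r i j) (cval (addr i) (addr j))) m')"
      using Suc.prems j sep by (intro pair_body addr_ge addr_le) auto
  next
    fix c :: config assume "case c of (pc, m') \<Rightarrow> pc = 8 \<and>
      inner_inv (addr i) (addr j + s) (max (row_max r i j) (cval (addr i) (addr j))) m'"
    then obtain m2 where c: "c = (8, m2)" and inv: "inner_inv (addr i) (addr (Suc j)) (row_max r i (Suc j)) m2"
      by (cases c) (auto simp: addr_Suc)
    show "reach {..<K} ((19 * d + 27) * (i - Suc j)) c
       (\<lambda>(pc, m'). pc = 8 \<and> inner_inv (addr i) (addr i) (row_max r i i) m')"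
      unfolding c using Suc.hyps Suc.prems inv j by (intro Suc.hyps(1)) auto
  qed
  from reach_srun[OF 1 this] show ?case
  proof (rule reach_mono)
    have "i - j = Suc (i - Suc j)" using j by simp
    then show "1 + (19 * d + 26 + (19 * d + 27) * (i - Suc j)) \<le> (19 * d + 27) * (i - j)" by simp
  qed
qed

text \<open>Holds at instruction 6, the head of the loop over the outer records.\<close>

definition outer_inv :: "nat \<Rightarrow> memory \<Rightarrow> bool" where
  "outer_inv i m \<longleftrightarrow> frame m \<and> m 0 = total_max i \<and> m 2 = real (addr i)"

lemma outer_step:
  assumes inv: "outer_inv i m" and i: "i < N"
  shows "reach {..<K} ((19 * d + 27) * N + 5) (6, m) (\<lambda>(pc, m'). pc = 6 \<and> outer_inv (Suc i) m')"
proof -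
  have lt: "addr i < K" using i by (simp flip: addr_N)
  have "\<exists>m1. srun {..<K} 2 (6, m) = Some (8, m1) \<and> inner_inv (addr i) (addr 0) (total_max i) m1"
    using inv lt K_ge by (simp add: srun_simps inner_inv_def outer_inv_def frame_def addr_def[of 0])
  then obtain m1 where m1: "srun {..<K} 2 (6, m) = Some (8, m1)"
    "inner_inv (addr i) (addr 0) (row_max (total_max i) i 0) m1" by auto
  have "reach {..<K} ((19 * d + 27) * (i - 0) + 3) (8, m1) (\<lambda>(pc, m'). pc = 6 \<and> outer_inv (Suc i) m')"
  proof (rule reach_trans[OF inner_loop[OF m1(2) _ i]])
    fix c :: config assume "case c of (pc, m') \<Rightarrow> pc = 8 \<and> inner_inv (addr i) (addr i) (row_max (total_max i) i i) m'"
    then obtain m2 where c: "c = (8, m2)" and inv: "inner_inv (addr i) (addr i) (total_max (Suc i)) m2"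
      by (cases c) auto
    have "\<exists>m3. srun {..<K} 3 (8, m2) = Some (6, m3) \<and> outer_inv (Suc i) m3"
      using inv K_ge by (simp add: srun_simps inner_inv_def outer_inv_def frame_def addr_Suc)
    then obtain m3 where m3: "srun {..<K} 3 (8, m2) = Some (6, m3)" "outer_inv (Suc i) m3" by blast
    have "reach {..<K} 0 (6, m3) (\<lambda>(pc, m'). pc = 6 \<and> outer_inv (Suc i) m')"
      using m3(2) by (intro reach_refl) simp
    from reach_srun[OF m3(1) this] show "reach {..<K} 3 c (\<lambda>(pc, m'). pc = 6 \<and> outer_inv (Suc i) m')"
      unfolding c by simp
  qed simp
  from reach_srun[OF m1(1) this] show ?thesis
  proof (rule reach_mono)
    have "(19 * d + 27) * i \<le> (19 * d + 27) * N" using i by (intro mult_le_mono2) simp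
    then show "2 + ((19 * d + 27) * (i - 0) + 3) \<le> (19 * d + 27) * N + 5" by simp
  qed
qed

lemma outer_loop:
  "outer_inv i m \<Longrightarrow> i \<le> N \<Longrightarrow>
    reach {..<K} (((19 * d + 27) * N + 5) * (N - i)) (6, m) (\<lambda>(pc, m'). pc = 6 \<and> outer_inv N m')"
proof (induction "N - i" arbitrary: i m)
  case 0
  then show ?case by (intro reach_refl) auto
next
  case (Suc n)
  then have i: "i < N" by simp
  have "reach {..<K} (((19 * d + 27) * N + 5) + ((19 * d + 27) * N + 5) * (N - Suc i)) (6, m)
     (\<lambda>(pc, m'). pc = 6 \<and> outer_inv N m')"
  proof (rule reach_trans[OF outer_step[OF Suc.prems(1) i]])
    fix c :: config assume "case c of (pc, m') \<Rightarrow> pc = 6 \<and> outer_inv (Suc i) m'"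
    then obtain m2 where c: "c = (6, m2)" and inv: "outer_inv (Suc i) m2" by (cases c) auto
    show "reach {..<K} (((19 * d + 27) * N + 5) * (N - Suc i)) c (\<lambda>(pc, m'). pc = 6 \<and> outer_inv N m')"
      unfolding c using Suc.hyps(2) i by (intro Suc.hyps(1) inv) auto
  qed
  then show ?case
  proof (rule reach_mono)
    have "N - i = Suc (N - Suc i)" using i by simp
    then show "((19 * d + 27) * N + 5) + ((19 * d + 27) * N + 5) * (N - Suc i) \<le> ((19 * d + 27) * N + 5) * (N - i)"
      by simp
  qed
qed

lemma program_correct:
  assumes m: "\<And>i. i \<ge> 20 \<Longrightarrow> m i = I i" "\<And>i. i < 20 \<Longrightarrow> m i = 0"
  shows "reach {..<K} (((19 * d + 27) * N + 5) * N + 7) (0, m) (\<lambda>(pc, m'). pc = length lip_program \<and> m' 0 = total_max N)"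
proof -
  have "\<exists>m1. srun {..<K} 6 (0, m) = Some (6, m1) \<and> outer_inv 0 m1"
    using m K_ge I_d I_N
    by (simp add: srun_simps outer_inv_def frame_def addr_def s_def K_def algebra_simps)
  then obtain m1 where m1: "srun {..<K} 6 (0, m) = Some (6, m1)" "outer_inv 0 m1" by blast
  have "reach {..<K} (((19 * d + 27) * N + 5) * (N - 0) + 1) (6, m1)
     (\<lambda>(pc, m'). pc = length lip_program \<and> m' 0 = total_max N)"
  proof (rule reach_trans[OF outer_loop[OF m1(2)]])
    fix c :: config assume "case c of (pc, m') \<Rightarrow> pc = 6 \<and> outer_inv N m'"
    then obtain m2 where c: "c = (6, m2)" and inv: "outer_inv N m2" by (cases c) auto
    have 1: "srun {..<K} 1 (6, m2) = Some (55, m2)"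
      using inv K_ge by (simp add: srun_simps outer_inv_def frame_def addr_N)
    have "reach {..<K} 0 (55, m2) (\<lambda>(pc, m'). pc = length lip_program \<and> m' 0 = total_max N)"
      using inv by (intro reach_refl) (simp add: length_lip_program outer_inv_def)
    from reach_srun[OF 1 this] show "reach {..<K} 1 c (\<lambda>(pc, m'). pc = length lip_program \<and> m' 0 = total_max N)"
      unfolding c by simp
  qed simp
  from reach_srun[OF m1(1) this] show ?thesis by (rule reach_mono) auto
qed

lemma row_max_ge: "r \<le> row_max r i j" "j' < j \<Longrightarrow> cval (addr i) (addr j') \<le> row_max r i j"
  by (induction j) (auto simp: less_Suc_eq le_max_iff_disj)

lemma row_max_attained: "row_max r i j = r \<or> (\<exists>j'<j. row_max r i j = cval (addr i) (addr j'))"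
  by (induction j) (auto simp: less_Suc_eq max_def)

lemma total_max_ge: "i < n \<Longrightarrow> j < i \<Longrightarrow> cval (addr i) (addr j) \<le> total_max n"
proof (induction n)
  case (Suc n)
  then show ?case
    using row_max_ge(1)[of "total_max n" n n] row_max_ge(2)[of j n n "total_max n"]
    by (cases "i = n") auto
qed simp

lemma total_max_attained: "total_max n = 0 \<or> (\<exists>i<n. \<exists>j<i. total_max n = cval (addr i) (addr j))"
proof (induction n)
  case (Suc n)
  then show ?case using row_max_attained[of "total_max n" n n] less_SucI lessI by (metis total_max.simps(2))
qed simp

end

section \<open>The input encoding and the algorithm\<close>

lemma length_concat_uniform:
  "(\<And>y. y \<in> set ys \<Longrightarrow> length y = s) \<Longrightarrow> length (concat ys) = length ys * s"
  by (induction ys) auto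

lemma nth_concat_uniform:
  "(\<And>y. y \<in> set ys \<Longrightarrow> length y = s) \<Longrightarrow> i < length ys \<Longrightarrow> k < s \<Longrightarrow>
    concat ys ! (i * s + k) = ys ! i ! k"
proof (induction ys arbitrary: i)
  case (Cons y ys)
  then show ?case by (cases i) (auto simp: nth_append)
qed simp

lemma nth_record:
  assumes "x \<in> carrier_vec d" "g \<in> carrier_vec d"
  shows "k < d \<Longrightarrow> (list_of_vec x @ [v] @ list_of_vec g) ! k = x $ k"
    and "(list_of_vec x @ [v] @ list_of_vec g) ! d = v"
    and "k < d \<Longrightarrow> (list_of_vec x @ [v] @ list_of_vec g) ! (d + 1 + k) = g $ k"
    and "length (list_of_vec x @ [v] @ list_of_vec g) = 2 * d + 1"
  using assms by (auto simp: nth_append)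

theorem corollary2:
  shows "\<exists>(alg :: instr list \<times> nat) (C :: real).
    \<forall>(d :: nat) (E :: real vec set) (P :: real vec \<Rightarrow> real vec \<Rightarrow> real) (xs :: real vec list).
      d \<ge> 1 \<longrightarrow> E \<subseteq> carrier_vec d \<longrightarrow> one_field d E P \<longrightarrow> set xs = E \<longrightarrow> distinct xs \<longrightarrow>
      (\<exists>(r :: real) (work :: nat) (storage :: nat).
         computes alg (encode_field d xs P) r work storage \<and>
         ereal r = minimal_Lip d E P \<and>
         (E \<noteq> {} \<longrightarrow>
            real work \<le> C * (real d * real (card E) ^ 2) \<and>
            real storage \<le> C * (real d * real (card E))))"
proof (rule exI[of _ "(lip_program, 20)"], rule exI[of _ "58 :: real"], intro allI impI)
  fix d :: nat and E :: "real vec set" and P :: "real vec \<Rightarrow> real vec \<Rightarrow> real" and xs :: "real vec list"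
  assume d: "d \<ge> 1" and E: "E \<subseteq> carrier_vec d" and P: "one_field d E P"
    and xs: "set xs = E" "distinct xs"
  \<comment> \<open>the general step bound \<open>19 d N\<^sup>2 + 27 N\<^sup>2 + 5 N + 7\<close> has coefficient sum 58\<close>
  define N where "N = length xs"
  define G where "G = (\<lambda>x. gradient d (P x) x)"
  define recd where "recd = (\<lambda>x. list_of_vec x @ [P x x] @ list_of_vec (G x))"
  define inp where "inp = encode_field d xs P"
  define I where "I = initial_memory 20 inp"
  have cx: "xs ! i \<in> carrier_vec d" if "i < N" for i
    using E xs(1) that nth_mem[of i xs] by (auto simp: N_def)
  have cG: "G x \<in> carrier_vec d" if "x \<in> E" for x
    using affine_jet(1)[of d "P x" x] that E P by (auto simp: G_def one_field_def)
  have cGx: "G (xs ! i) \<in> carrier_vec d" if "i < N" for i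
    using cG xs(1) that nth_mem[of i xs] by (auto simp: N_def)
  have rec_len: "length y = 2 * d + 1" if "y \<in> set (map recd xs)" for y
  proof -
    obtain x where x: "x \<in> E" "y = recd x" using \<open>y \<in> set (map recd xs)\<close> xs(1) by auto
    then have "x \<in> carrier_vec d" using E by blast
    then show ?thesis unfolding x(2) recd_def by (rule nth_record(4)[OF _ cG[OF x(1)]])
  qed
  have inp: "inp = [real d, real N] @ concat (map recd xs)"
    by (simp add: inp_def encode_field_def recd_def G_def N_def)
  have len: "length inp = 2 + N * (2 * d + 1)"
    using length_concat_uniform[of "map recd xs" "2 * d + 1", OF rec_len] by (simp add: inp N_def)
  have I_rec: "I (22 + i * (2 * d + 1) + k) = recd (xs ! i) ! k" if "i < N" "k < 2 * d + 1" for i k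
  proof -
    have "i * (2 * d + 1) + k < (i + 1) * (2 * d + 1)" using that by simp
    also have "\<dots> \<le> N * (2 * d + 1)" using that by (intro mult_le_mono1) simp
    finally have lt: "i * (2 * d + 1) + k < N * (2 * d + 1)" .
    then have "I (22 + i * (2 * d + 1) + k) = inp ! (2 + (i * (2 * d + 1) + k))"
      unfolding I_def initial_memory_def len by (simp add: algebra_simps)
    also have "\<dots> = concat (map recd xs) ! (i * (2 * d + 1) + k)"
      by (simp add: inp)
    also have "\<dots> = recd (xs ! i) ! k"
      using nth_concat_uniform[of "map recd xs" "2 * d + 1" i k, OF rec_len _ that(2)] that(1) by (simp add: N_def)
    finally show ?thesis .
  qed
  interpret L: layout I d N
    by unfold_locales (simp_all add: I_def initial_memory_def inp)
  have I_x: "I (L.addr i + k) = xs ! i $ k" if "i < N" "k < d" for i k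
    using I_rec[of i k] nth_record(1)[OF cx cGx, of i i k] that
    by (simp add: L.addr_def L.s_def recd_def)
  have I_v: "I (L.addr i + d) = P (xs ! i) (xs ! i)" if "i < N" for i
    using I_rec[of i d] nth_record(2)[OF cx cGx, of i i] that
    by (simp add: L.addr_def L.s_def recd_def)
  have I_g: "I (L.addr i + d + 1 + k) = G (xs ! i) $ k" if "i < N" "k < d" for i k
    using I_rec[of i "d + 1 + k"] nth_record(3)[OF cx cGx, of i i k] that
    by (simp add: L.addr_def L.s_def recd_def add.assoc)
  have sums: "L.sumS (L.addr i) (L.addr j) d = (xs ! i - xs ! j) \<bullet> (xs ! i - xs ! j)"
    "L.sumT (L.addr i) (L.addr j) d = (G (xs ! i) - G (xs ! j)) \<bullet> (G (xs ! i) - G (xs ! j))"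
    "L.sumW (L.addr i) (L.addr j) d = (G (xs ! i) + G (xs ! j)) \<bullet> (xs ! j - xs ! i)"
    if "i < N" "j < N" for i j
    unfolding L.sumS_def L.sumT_def L.sumW_def
    using that cx[of i] cx[of j] cGx[of i] cGx[of j]
    by (simp_all add: sprod_sum[where d = d] I_x I_g[simplified] cong: sum.cong_simp)
      (simp_all add: algebra_simps)
  have cval: "L.cval (L.addr i) (L.addr j) = field_const d P (xs ! i) (xs ! j)" if "i < N" "j < N" for i j
    using that by (simp add: L.cval_def L.slope_def sums I_v pair_const_def Let_def G_def)
  interpret separated_layout I d N
  proof unfold_locales
    fix i j assume ij: "i < N" "j < i"
    then have "xs ! i \<noteq> xs ! j" using xs(2) by (simp add: N_def nth_eq_iff_index_eq)
    then show "L.sumS (L.addr i) (L.addr j) d \<noteq> 0"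
      using sprod_self_minus_pos[OF cx cx, of i j] ij by (simp add: sums)
  qed
  define r where "r = L.total_max N"
  have "minimal_Lip d E P = ereal r"
  proof (rule minimal_Lip_eqI[OF d _ E P])
    show "finite E" using xs(1) by auto
  next
    fix x y assume xy: "x \<in> E" "y \<in> E" "x \<noteq> y"
    obtain i j where i: "i < N" "x = xs ! i" and j: "j < N" "y = xs ! j"
      using xy xs(1) by (metis N_def in_set_conv_nth)
    have "i \<noteq> j" using i j xy by blast
    then consider "j < i" | "i < j" by linarith
    then show "field_const d P x y \<le> r"
    proof cases
      case 1
      then show ?thesis using total_max_ge[OF i(1) 1] cval[OF i(1) j(1)] by (simp add: r_def i j)
    next
      case 2
      have "field_const d P x y = field_const d P y x"
        using pair_const_commute[OF cx cx, of i j "\<lambda>x. gradient d (P x) x"] cGx i j by (simp add: G_def)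
      then show ?thesis using total_max_ge[OF j(1) 2] cval[OF j(1) i(1)] by (simp add: r_def i j)
    qed
  next
    from total_max_attained[of N] show "r = 0 \<or> (\<exists>x\<in>E. \<exists>y\<in>E. x \<noteq> y \<and> r = field_const d P x y)"
    proof
      assume "\<exists>i<N. \<exists>j<i. L.total_max N = L.cval (L.addr i) (L.addr j)"
      then obtain i j where ij: "i < N" "j < i" and r: "r = L.cval (L.addr i) (L.addr j)"
        by (auto simp: r_def)
      then have "r = field_const d P (xs ! i) (xs ! j)" using cval by simp
      moreover have "xs ! i \<in> E" "xs ! j \<in> E" "xs ! i \<noteq> xs ! j"
        using ij xs by (auto simp: N_def nth_eq_iff_index_eq)
      ultimately show ?thesis by blast
    qed (simp add: r_def)
  qed
  moreover have "reach {..<L.K} (((19 * d + 27) * N + 5) * N + 7) (0, I)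
      (\<lambda>(pc, m'). pc = length lip_program \<and> m' 0 = r)"
    unfolding r_def by (rule program_correct) (simp_all add: I_def initial_memory_def)
  then obtain work A m where work: "work \<le> ((19 * d + 27) * N + 5) * N + 7" and A: "A \<subseteq> {..<L.K}"
    and run: "run lip_program (0, I) work A (length lip_program, m)" "m 0 = r"
    unfolding reach_def by auto
  define storage where "storage = card (A \<union> {20..<20 + length inp})"
  have "computes (lip_program, 20) inp r work storage"
    unfolding computes_def storage_def using run by (auto simp: I_def)
  moreover have "real work \<le> 58 * (real d * real (card E) ^ 2) \<and> real storage \<le> 58 * (real d * real (card E))"
    if ne: "E \<noteq> {}"
  proof
    have card: "card E = N" using xs distinct_card by (auto simp: N_def)
    have N: "N \<ge> 1" using ne xs(1) by (cases xs) (auto simp: N_def)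
    have 1: "N \<le> d * N^2" "1 \<le> d * N^2" "N^2 \<le> d * N^2" "1 \<le> d * N" "N \<le> d * N"
      using d N by (auto simp: power2_eq_square Suc_le_eq)
    have "work \<le> 19 * (d * N^2) + 27 * N^2 + 5 * N + 7"
      using work by (simp add: power2_eq_square algebra_simps)
    also have "\<dots> \<le> 58 * (d * N^2)" using 1 by linarith
    finally have "real work \<le> real (58 * (d * N^2))" by (rule of_nat_mono)
    then show "real work \<le> 58 * (real d * real (card E) ^ 2)" by (simp add: card)
    have "storage \<le> card {..<L.K}"
      unfolding storage_def using A by (intro card_mono) (auto simp: len L.K_def L.s_def)
    also have "\<dots> = 2 * (d * N) + N + 22" by (simp add: L.K_def L.s_def algebra_simps)
    also have "\<dots> \<le> 58 * (d * N)" using 1 by linarith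
    finally have "real storage \<le> real (58 * (d * N))" by (rule of_nat_mono)
    then show "real storage \<le> 58 * (real d * real (card E))" by (simp add: card)
  qed
  ultimately show "\<exists>(r :: real) (work :: nat) (storage :: nat).
         computes (lip_program, 20) (encode_field d xs P) r work storage \<and>
         ereal r = minimal_Lip d E P \<and>
         (E \<noteq> {} \<longrightarrow>
            real work \<le> 58 * (real d * real (card E) ^ 2) \<and>
            real storage \<le> 58 * (real d * real (card E)))"
    unfolding inp_def by (intro exI[of _ r] exI[of _ work] exI[of _ storage]) simp
qed

end
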